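(* Let $f_1,\dots,f_n:\mathbb{R}^p\to\mathbb{R}$ be twice differentiable and $F(\mathbf{x})=\frac1n\sum_{i=1}^n f_i(\mathbf{x})$. Assume that there are constants $0<K_i<\infty$ with $0\preceq\nabla^2 f_i(\mathbf{x})\preceq K_i\mathbb{I}$ for all $\mathbf{x}\in\mathbb{R}^p$ and $i=1,\dots,n$, and constants $0<\gamma\le K<\infty$ with $\gamma\mathbb{I}\preceq\nabla^2F(\mathbf{x})\preceq K\mathbb{I}$ for all $\mathbf{x}\in\mathbb{R}^p$; let $\mathbf{x}^*$ be the minimizer of $F$. Let $0<\delta<1$, $0<\epsilon<1$, $0<\beta<1$, $\widehat\alpha\ge1$. For any $\mathbf{x}^{(k)}\in\mathbb{R}^p$, let $\mathbf{x}^{(k+1)}$ be obtained from $\mathbf{x}^{(k)}$ by one iteration of the sub-sampled Newton algorithm described in the context (sub-sampled Hessian, full gradient, exact update). Then, with probability $1-\delta$, $$F(\mathbf{x}^{(k+1)})-F(\mathbf{x}^* )\le(1-\rho)\big(F(\mathbf{x}^{(k)})-F(\mathbf{x}^* )\big),\qquad \rho=\frac{2\alpha_k\beta}{\tilde\kappa}.$$ Moreover, the step size is at least $$\alpha_k\ge\frac{2(1-\beta)(1-\epsilon)}{\kappa}.$$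
   Context: Condition numbers: $\kappa=K/\gamma$. For an integer $1\le q\le n$, $\widehat K_q$ is the average of the $q$ largest values among $K_1,\dots,K_n$, and $\kappa_q=\widehat K_q/\gamma$. For a sample $\mathcal{S}$, $\tilde\kappa=\kappa_1$ if $\mathcal{S}$ is drawn with replacement, and $\tilde\kappa=\kappa_{|\mathcal{S}|}$ if it is drawn without replacement. Algorithm (one iteration). The sample size satisfies $|\mathcal{S}|\ge 2\kappa_1\ln(p/\delta)/\epsilon^2$. A collection $\mathcal{S}$ of $|\mathcal{S}|$ indices is drawn from $\{1,\dots,n\}$ uniformly at random, with or without replacement, and $H(\mathbf{x}^{(k)})=\frac1{|\mathcal{S}|}\sum_{j\in\mathcal{S}}\nabla^2f_j(\mathbf{x}^{(k)})$. Then $\mathbf{x}^{(k+1)}=\mathbf{x}^{(k)}+\alpha_k\mathbf{p}_k$, where $\mathbf{p}_k=-[H(\mathbf{x}^{(k)})]^{-1}\nabla F(\mathbf{x}^{(k)})$ and $\alpha_k$ is the largest $\alpha\le\widehat\alpha$ such that $F(\mathbf{x}^{(k)}+\alpha\mathbf{p}_k)\le F(\mathbf{x}^{(k)})+\alpha\beta\,\mathbf{p}_k^T\nabla F(\mathbf{x}^{(k)})$. "With probability $1-\delta$" means with probability at least $1-\delta$ over the draw of $\mathcal{S}$, and refers to all conclusions. $A\preceq B$ means $B-A$ is symmetric positive semi-definite.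
   Formalization: The step-size bound is proved as α_k ≥ min(α̂, 2(1−β)(1−ε)/κ), because the printed bound fails whenever 2(1−β)(1−ε)/κ exceeds α̂ (e.g. κ = α̂ = 1, β = ε = 1/4), as the line search enforces α_k ≤ α̂. *)

theory Defs
  imports "HOL-Probability.Probability"
begin

section \<open>Gradients, Hessians and the Loewner order\<close>

definition gradient :: "(real ^ 'p \<Rightarrow> real) \<Rightarrow> real ^ 'p \<Rightarrow> real ^ 'p" where
  "gradient f x = (THE g. GDERIV f x :> g)"

definition hessian :: "(real ^ 'p \<Rightarrow> real) \<Rightarrow> real ^ 'p \<Rightarrow> real ^ 'p ^ 'p" where
  "hessian f x = jacobian (gradient f) (at x)"

text \<open>Frechet differentiability of both \<open>f\<close> and its gradient, everywhere;
  continuity of the second derivative is not required.\<close>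

definition twice_differentiable :: "(real ^ 'p \<Rightarrow> real) \<Rightarrow> bool" where
  "twice_differentiable f \<longleftrightarrow>
     (\<forall>x. f differentiable (at x)) \<and> (\<forall>x. gradient f differentiable (at x))"

definition symmetric_psd :: "real ^ 'p ^ 'p \<Rightarrow> bool" where
  "symmetric_psd A \<longleftrightarrow> transpose A = A \<and> (\<forall>v. 0 \<le> v \<bullet> (A *v v))"

definition loewner_le :: "real ^ 'p ^ 'p \<Rightarrow> real ^ 'p ^ 'p \<Rightarrow> bool"  (infix \<open>\<preceq>\<close> 50) where
  "A \<preceq> B \<longleftrightarrow> symmetric_psd (B - A)"


section \<open>Finite-sum objective and condition numbers\<close>

definition objective :: "nat \<Rightarrow> (nat \<Rightarrow> real ^ 'p \<Rightarrow> real) \<Rightarrow> real ^ 'p \<Rightarrow> real" where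
  "objective n f x = (\<Sum>i = 1..n. f i x) / real n"

text \<open>Average of the \<open>q\<close> largest values (counted with multiplicity) among
  \<open>Ks 1, \<dots>, Ks n\<close>; intended for \<open>1 \<le> q \<le> n\<close>.\<close>

definition top_avg :: "nat \<Rightarrow> (nat \<Rightarrow> real) \<Rightarrow> nat \<Rightarrow> real" where
  "top_avg n Ks q = sum_list (take q (rev (sort (map Ks [1..<n + 1])))) / real q"

definition cond_num :: "nat \<Rightarrow> (nat \<Rightarrow> real) \<Rightarrow> real \<Rightarrow> nat \<Rightarrow> real" where
  "cond_num n Ks \<gamma> q = top_avg n Ks q / \<gamma>"


section \<open>Uniform sampling of indices\<close>

datatype sampling = With_Replacement | Without_Replacement

text \<open>A sample of size \<open>m\<close> is the list of the successively drawn indices. Without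
  replacement the set of samples is empty if \<open>m > n\<close>, and \<open>sample_pmf\<close> is then unspecified.\<close>

fun samples :: "sampling \<Rightarrow> nat \<Rightarrow> nat \<Rightarrow> nat list set" where
  "samples With_Replacement n m = {S. length S = m \<and> set S \<subseteq> {1..n}}"
| "samples Without_Replacement n m = {S. length S = m \<and> set S \<subseteq> {1..n} \<and> distinct S}"

definition sample_pmf :: "sampling \<Rightarrow> nat \<Rightarrow> nat \<Rightarrow> nat list pmf" where
  "sample_pmf md n m = pmf_of_set (samples md n m)"

fun sample_cond_num :: "sampling \<Rightarrow> nat \<Rightarrow> (nat \<Rightarrow> real) \<Rightarrow> real \<Rightarrow> nat \<Rightarrow> real" where
  "sample_cond_num With_Replacement n Ks \<gamma> m = cond_num n Ks \<gamma> 1"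
| "sample_cond_num Without_Replacement n Ks \<gamma> m = cond_num n Ks \<gamma> m"


section \<open>One iteration of the sub-sampled Newton algorithm\<close>

definition sub_hessian ::
    "(nat \<Rightarrow> real ^ 'p \<Rightarrow> real) \<Rightarrow> nat list \<Rightarrow> real ^ 'p \<Rightarrow> real ^ 'p ^ 'p" where
  "sub_hessian f S x = (1 / real (length S)) *\<^sub>R (\<Sum>j\<leftarrow>S. hessian (f j) x)"

definition newton_direction ::
    "nat \<Rightarrow> (nat \<Rightarrow> real ^ 'p \<Rightarrow> real) \<Rightarrow> nat list \<Rightarrow> real ^ 'p \<Rightarrow> real ^ 'p" where
  "newton_direction n f S x = - (matrix_inv (sub_hessian f S x) *v gradient (objective n f) x)"

definition armijo ::
    "(real ^ 'p \<Rightarrow> real) \<Rightarrow> real \<Rightarrow> real ^ 'p \<Rightarrow> real ^ 'p \<Rightarrow> real \<Rightarrow> bool" where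
  "armijo F \<beta> x d \<alpha> \<longleftrightarrow> F (x + \<alpha> *\<^sub>R d) \<le> F x + \<alpha> * \<beta> * (d \<bullet> gradient F x)"

definition line_search_step ::
    "(real ^ 'p \<Rightarrow> real) \<Rightarrow> real \<Rightarrow> real \<Rightarrow> real ^ 'p \<Rightarrow> real ^ 'p \<Rightarrow> real \<Rightarrow> bool" where
  "line_search_step F \<beta> \<alpha>max x d \<alpha> \<longleftrightarrow>
     \<alpha> \<le> \<alpha>max \<and> armijo F \<beta> x d \<alpha> \<and> (\<forall>a. a \<le> \<alpha>max \<and> armijo F \<beta> x d a \<longrightarrow> a \<le> \<alpha>)"

text \<open>\<open>newton_iteration n f \<beta> \<alpha>max S x \<alpha> y\<close>: with the sample \<open>S\<close>, the iteration started
  at \<open>x\<close> is well defined and yields the step size \<open>\<alpha>\<close> and the next iterate \<open>y\<close>. Requiring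
  invertibility matters because \<open>matrix_inv\<close> is a total function; \<open>\<alpha>\<close> and \<open>y\<close> are
  determined by the other arguments.\<close>

definition newton_iteration ::
    "nat \<Rightarrow> (nat \<Rightarrow> real ^ 'p \<Rightarrow> real) \<Rightarrow> real \<Rightarrow> real \<Rightarrow> nat list \<Rightarrow> real ^ 'p
      \<Rightarrow> real \<Rightarrow> real ^ 'p \<Rightarrow> bool" where
  "newton_iteration n f \<beta> \<alpha>max S x \<alpha> y \<longleftrightarrow>
     invertible (sub_hessian f S x) \<and>
     line_search_step (objective n f) \<beta> \<alpha>max x (newton_direction n f S x) \<alpha> \<and>
     y = x + \<alpha> *\<^sub>R newton_direction n f S x"

end

theory Submission
  imports Defs
begin

text \<open>With probability at least \<open>1 - \<delta>\<close> the sampled Hessian satisfies \<open>(1 - \<epsilon>) \<gamma> I \<preceq> H\<close>; given this, the Armijo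
  condition holds up to the step \<open>2 (1 - \<beta>) (1 - \<epsilon>) \<gamma> / K\<close> by Taylor expansion, and the decrease follows
  from \<open>H \<preceq> \<kappa> \<gamma> I\<close>, with \<open>\<kappa>\<close> the condition number of the sample, and
  \<open>2 \<gamma> (F x - F x\<^sup>*) \<le> |\<nabla>F x|\<^sup>2\<close>.

  The probabilistic part is a matrix Chernoff bound. Instead of \<open>tr (exp S)\<close> it uses the potential
  \<open>tr ((I + S / N)\<^bsup>N\<^esup>)\<close> with \<open>N = 2\<^bsup>k\<^esup>\<close>, which avoids both the spectral theorem and the matrix
  exponential: all trace inequalities for powers of two follow by repeated Cauchy--Schwarz. A
  Golden--Thompson inequality with error \<open>O(1/N)\<close> allows the terms of the sum to be averaged one at a
  time, midpoint convexity of the potential reduces sampling without replacement to sampling with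
  replacement, and finally \<open>k\<close> tends to infinity.\<close>

section \<open>Trace inequalities for powers of matrices\<close>

text \<open>Only the lower bound on the sampled Hessian is random. The upper bound holds for every
  sample, because the sampled \<open>Ks j\<close> average to at most the constant in question. So
  one one-sided tail suffices, and the dimension p enters once, as the trace of the identity, which
  is the potential of the empty sample. With R the largest \<open>Ks i\<close> and u = m \<gamma> /
  R, optimizing \<theta> gives the failure bound p exp (- u \<epsilon>^2 / 2). Asking that it be at
  most \<delta> yields the stated sample size, with R / \<gamma> as kappa_1.

  An obstacle is that I + S / N need not be positive semi-definite for a given N. Even powers repair
  this: an even power of a symmetric matrix is the square of a symmetric matrix, so its trace is a
  squared Frobenius norm.

  The step size is bounded below by a minimum with \<open>\<alpha>max\<close>: for kappa = 1 and
  small \<beta> and \<epsilon> the value 2 (1 - \<beta>) (1 - \<epsilon>) / kappa exceeds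
  \<open>\<alpha>max\<close> = 1, and no admissible step can reach it.\<close>

primrec matpow :: "real ^ 'p ^ 'p \<Rightarrow> nat \<Rightarrow> real ^ 'p ^ 'p" where
  "matpow A 0 = mat 1"
| "matpow A (Suc n) = A ** matpow A n"

lemma matpow_add: "matpow A (i + j) = matpow A i ** matpow A j"
  by (induction i) (simp_all add: matrix_mul_assoc)

lemma matpow_commute: "matpow A i ** A = A ** matpow A i"
  using matpow_add[of A i 1] matpow_add[of A 1 i] by (simp add: add.commute)

lemma matpow_mult: "matpow A (i * j) = matpow (matpow A i) j"
  by (induction j) (simp_all add: matpow_add)

lemma matpow_two: "matpow A 2 = A ** A"
  by (simp add: numeral_2_eq_2)

lemma matpow_double: "matpow A (2 * j) = matpow A j ** matpow A j"
  by (simp add: mult_2 matpow_add)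

lemma transpose_matpow: "transpose (matpow A n) = matpow (transpose A) n"
  by (induction n) (simp_all add: matrix_transpose_mul matpow_commute)

lemma matpow_shift: "matpow (A ** B) n ** A = A ** matpow (B ** A) n"
proof (induction n)
  case (Suc n)
  have "matpow (A ** B) (Suc n) ** A = A ** (B ** (matpow (A ** B) n ** A))"
    by (simp add: matrix_mul_assoc)
  also have "\<dots> = A ** matpow (B ** A) (Suc n)"
    unfolding Suc by (simp add: matrix_mul_assoc)
  finally show ?case .
qed simp

lemma trace_matpow_cyclic:
  fixes A B :: "real ^ 'p ^ 'p"
  shows "trace (matpow (A ** B) n) = trace (matpow (B ** A) n)"
proof (cases n)
  case (Suc k)
  have "trace (matpow (A ** B) n) = trace (matpow (A ** B) k ** A ** B)"
    by (simp add: Suc matpow_commute[symmetric] matrix_mul_assoc)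
  also have "\<dots> = trace (A ** matpow (B ** A) k ** B)"
    by (simp add: matpow_shift)
  also have "\<dots> = trace (B ** (A ** matpow (B ** A) k))"
    by (rule trace_mul_sym)
  finally show ?thesis
    by (simp add: Suc matrix_mul_assoc)
qed simp

text \<open>Identifies the inner product of the type as the Frobenius one, so that inequalities
  between traces can come from positivity of an inner product.\<close>

lemma inner_matrix_eq_trace: "(A :: real ^ 'p ^ 'q) \<bullet> B = trace (transpose A ** B)"
proof -
  have "A \<bullet> B = (\<Sum>i\<in>UNIV. \<Sum>j\<in>UNIV. A $ i $ j * B $ i $ j)"
    by (simp add: inner_vec_def)
  also have "\<dots> = (\<Sum>j\<in>UNIV. \<Sum>i\<in>UNIV. A $ i $ j * B $ i $ j)"
    by (rule sum.swap)
  also have "\<dots> = trace (transpose A ** B)"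
    by (simp add: trace_def matrix_matrix_mult_def transpose_def)
  finally show ?thesis .
qed

lemma trace_mult_scaleR: "trace (A ** (c *\<^sub>R B)) = c * trace (A ** (B :: real ^ 'p ^ 'p))"
  by (simp add: trace_def matrix_matrix_mult_def sum_distrib_left mult_ac)

text \<open>The arithmetic-mean form of Cauchy--Schwarz, from expanding the square of
  \<open>A - B\<close>; it avoids square roots and is enough throughout.\<close>

lemma trace_mult_le_half:
  "trace (transpose A ** B) \<le>
     (trace (transpose A ** A) + trace (transpose B ** B)) / (2 :: real)"
proof -
  have "0 \<le> (A - B) \<bullet> (A - B)"
    by simp
  then show ?thesis
    unfolding inner_matrix_eq_trace[symmetric]
    by (simp add: inner_diff_left inner_diff_right inner_commute)
qed

text \<open>The two trace inequalities feed each other: the second for \<open>M\<^sup>2\<close> leads to the product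
  of the symmetric matrices \<open>M\<^sup>T M\<close> and \<open>M M\<^sup>T\<close>, the first for \<open>A B\<close> to the product
  of \<open>A\<^sup>2\<close> and \<open>B\<^sup>2\<close>.\<close>

lemma trace_matpow_ineqs:
  "(\<forall>A B :: real ^ 'p ^ 'p. transpose A = A \<longrightarrow> transpose B = B \<longrightarrow>
      trace (matpow (A ** B) (2 ^ k)) \<le> trace (matpow A (2 ^ k) ** matpow B (2 ^ k))) \<and>
   (\<forall>M :: real ^ 'p ^ 'p.
      trace (matpow M (2 * 2 ^ k)) \<le> trace (matpow (transpose M ** M) (2 ^ k)))"
proof (induction k)
  case 0
  have "trace (M ** M) \<le> trace (transpose M ** M)" for M :: "real ^ 'p ^ 'p"
    using trace_mult_le_half[of "transpose M" M] by (simp add: trace_mul_sym[of M "transpose M"])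
  then show ?case
    by (simp add: matpow_two)
next
  case (Suc k)
  have C: "trace (matpow (A ** B) (2 ^ k)) \<le> trace (matpow A (2 ^ k) ** matpow B (2 ^ k))"
    if "transpose A = A" "transpose B = B" for A B :: "real ^ 'p ^ 'p"
    using Suc that by blast
  have D: "trace (matpow M (2 * 2 ^ k)) \<le> trace (matpow (transpose M ** M) (2 ^ k))"
    for M :: "real ^ 'p ^ 'p"
    using Suc by blast
  have "trace (matpow (A ** B) (2 ^ Suc k)) \<le> trace (matpow A (2 ^ Suc k) ** matpow B (2 ^ Suc k))"
    if [simp]: "transpose A = A" "transpose B = B" for A B :: "real ^ 'p ^ 'p"
  proof -
    have "trace (matpow (A ** B) (2 ^ Suc k)) \<le> trace (matpow (transpose (A ** B) ** (A ** B)) (2 ^ k))"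
      using D[of "A ** B"] by simp
    also have "transpose (A ** B) ** (A ** B) = B ** (A ** A ** B)"
      by (simp add: matrix_transpose_mul matrix_mul_assoc)
    also have "trace (matpow (B ** (A ** A ** B)) (2 ^ k)) = trace (matpow (A ** A ** B ** B) (2 ^ k))"
      by (rule trace_matpow_cyclic)
    also have "A ** A ** B ** B = (A ** A) ** (B ** B)"
      by (simp add: matrix_mul_assoc)
    also have "trace (matpow \<dots> (2 ^ k)) \<le> trace (matpow (A ** A) (2 ^ k) ** matpow (B ** B) (2 ^ k))"
      by (rule C) (simp_all add: matrix_transpose_mul)
    finally show ?thesis
      by (simp add: matpow_mult matpow_two)
  qed
  moreover have "trace (matpow M (2 * 2 ^ Suc k)) \<le> trace (matpow (transpose M ** M) (2 ^ Suc k))"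
    for M :: "real ^ 'p ^ 'p"
  proof -
    define P Q where "P = transpose M ** M" and "Q = M ** transpose M"
    have PQ: "transpose P = P" "transpose Q = Q"
      by (simp_all add: P_def Q_def matrix_transpose_mul)
    have "trace (matpow M (2 * 2 ^ Suc k)) = trace (matpow (M ** M) (2 * 2 ^ k))"
      using matpow_mult[of M 2 "2 * 2 ^ k"] by (simp only: power_Suc matpow_two)
    also have "\<dots> \<le> trace (matpow (transpose (M ** M) ** (M ** M)) (2 ^ k))"
      by (rule D)
    also have "transpose (M ** M) ** (M ** M) = transpose M ** (P ** M)"
      by (simp add: matrix_transpose_mul matrix_mul_assoc P_def)
    also have "trace (matpow (transpose M ** (P ** M)) (2 ^ k)) = trace (matpow (P ** Q) (2 ^ k))"
      using trace_matpow_cyclic[of "transpose M" "P ** M" "2 ^ k"] by (simp add: Q_def matrix_mul_assoc)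
    also have "\<dots> \<le> trace (matpow P (2 ^ k) ** matpow Q (2 ^ k))"
      by (rule C) (fact PQ)+
    also have "\<dots> \<le> (trace (matpow P (2 ^ Suc k)) + trace (matpow Q (2 ^ Suc k))) / 2"
      using trace_mult_le_half[of "matpow P (2 ^ k)" "matpow Q (2 ^ k)"]
      by (simp add: transpose_matpow PQ matpow_double)
    \<comment> \<open>Powers of \<open>M ** transpose M\<close> and \<open>transpose M ** M\<close>
      have equal traces, so the mean of the two collapses to one of them.\<close>
    also have "trace (matpow Q (2 ^ Suc k)) = trace (matpow P (2 ^ Suc k))"
      unfolding P_def Q_def by (rule trace_matpow_cyclic)
    finally show ?thesis
      by (simp add: P_def)
  qed
  ultimately show ?case
    by blast
qed

text \<open>A Lieb--Thirring type inequality for dyadic exponents. Applied to I + S / N and I + A /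
  N it separates the two factors, as Golden--Thompson does for exponentials.\<close>

lemma trace_matpow_mult_le:
  fixes A B :: "real ^ 'p ^ 'p"
  assumes "transpose A = A" "transpose B = B"
  shows "trace (matpow (A ** B) (2 ^ k)) \<le> trace (matpow A (2 ^ k) ** matpow B (2 ^ k))"
  using trace_matpow_ineqs assms by blast

text \<open>A Young inequality for tr (M^(N-1) A), N = 2^k, by induction on j: each use of
  \<open>trace_mult_le_half\<close> halves the weight of the mixed term and doubles the power of
  \<open>A\<close> in it. At j = k the mixed term is tr (A^N).\<close>

lemma trace_matpow_young:
  fixes A M :: "real ^ 'p ^ 'p"
  assumes [simp]: "transpose A = A" "transpose M = M" and "j \<le> k"
  shows "trace (matpow M (2 ^ k - 1) ** A) \<le>
    (1 - 1 / 2 ^ j) * trace (matpow M (2 ^ k)) +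
    1 / 2 ^ j * trace (matpow M (2 ^ k - 2 ^ j) ** matpow A (2 ^ j))"
  using \<open>j \<le> k\<close>
proof (induction j)
  case (Suc j)
  have le: "(2::nat) ^ Suc j \<le> 2 ^ k"
    using Suc by (intro power_increasing) auto
  obtain l where k: "k = Suc l"
    using Suc by (cases k) auto
  \<comment> \<open>The remainder of the exponent after \<open>P\<close> has taken half of 2^k: then
    \<open>P ** P\<close> is the full power of \<open>M\<close>, and 2 r = 2^k - 2^(j+1) is the
    exponent of the next mixed term.\<close>
  define r where "r = (2::nat) ^ l - 2 ^ j"
  have r: "2 ^ k - 2 ^ j = 2 ^ l + r" "2 ^ k - 2 ^ Suc j = r + r" "2 ^ k = 2 ^ l + (2 ^ l :: nat)"
    using le by (simp_all add: r_def k)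
  define P Q where "P = matpow M (2 ^ l)" and "Q = matpow M r ** matpow A (2 ^ j)"
  have tP: "transpose P = P" and
    tQ: "transpose Q = matpow A (2 ^ j) ** matpow M r"
    by (simp_all add: P_def Q_def transpose_matpow matrix_transpose_mul)
  have "trace (matpow M (2 ^ k - 2 ^ j) ** matpow A (2 ^ j)) = trace (transpose P ** Q)"
    by (simp only: tP r(1)) (simp add: P_def Q_def matpow_add matrix_mul_assoc)
  also have "\<dots> \<le> (trace (transpose P ** P) + trace (transpose Q ** Q)) / 2"
    by (rule trace_mult_le_half)
  also have "trace (transpose P ** P) = trace (matpow M (2 ^ k))"
    by (simp only: tP) (simp add: r(3) matpow_add P_def)
  also have "trace (transpose Q ** Q) =
      trace (matpow A (2 ^ j) ** (matpow M r ** matpow M r ** matpow A (2 ^ j)))"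
    by (simp only: tQ) (simp add: Q_def matrix_mul_assoc)
  also have "\<dots> = trace (matpow M (2 ^ k - 2 ^ Suc j) ** matpow A (2 ^ Suc j))"
    by (subst trace_mul_sym, simp only: r(2))
       (simp add: matpow_add matpow_double matrix_mul_assoc)
  finally have *: "trace (matpow M (2 ^ k - 2 ^ j) ** matpow A (2 ^ j)) \<le>
    (trace (matpow M (2 ^ k)) + trace (matpow M (2 ^ k - 2 ^ Suc j) ** matpow A (2 ^ Suc j))) / 2" .
  have "trace (matpow M (2 ^ k - 1) ** A) \<le>
      (1 - 1 / 2 ^ j) * trace (matpow M (2 ^ k)) +
      1 / 2 ^ j * trace (matpow M (2 ^ k - 2 ^ j) ** matpow A (2 ^ j))"
    using Suc by simp
  also have "\<dots> \<le> (1 - 1 / 2 ^ j) * trace (matpow M (2 ^ k)) + 1 / 2 ^ j *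
      ((trace (matpow M (2 ^ k)) + trace (matpow M (2 ^ k - 2 ^ Suc j) ** matpow A (2 ^ Suc j))) / 2)"
    by (intro add_left_mono mult_left_mono *) simp
  also have "\<dots> = (1 - 1 / 2 ^ Suc j) * trace (matpow M (2 ^ k)) + 1 / 2 ^ Suc j *
      trace (matpow M (2 ^ k - 2 ^ Suc j) ** matpow A (2 ^ Suc j))"
  proof -
    have "(1 - c) * u + c * ((u + v) / 2) = (1 - c / 2) * u + c / 2 * v" for c u v :: real
      by (simp add: field_simps)
    moreover have "(1::real) / 2 ^ Suc j = 1 / 2 ^ j / 2"
      by simp
    ultimately show ?thesis
      by metis
  qed
  finally show ?case .
qed simp

text \<open>With M the midpoint, 2 M^N = M^(N-1) (A + B). Young's inequality for \<open>A\<close>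
  and for \<open>B\<close> bounds the trace of the right side; the multiples of tr (M^N) cancel up
  to the weight 1/N, which divides out.\<close>

lemma trace_matpow_midpoint_convex:
  fixes A B :: "real ^ 'p ^ 'p"
  assumes tA: "transpose A = A" and tB: "transpose B = B"
  shows "trace (matpow ((1/2) *\<^sub>R (A + B)) (2 ^ k)) \<le>
    (trace (matpow A (2 ^ k)) + trace (matpow B (2 ^ k))) / 2"
proof -
  define M where "M = (1/2) *\<^sub>R (A + B)"
  have tM: "transpose M = M"
    using tA tB by (simp add: M_def transpose_scalar) (simp add: transpose_def vec_eq_iff)
  obtain N where N: "(2::nat) ^ k = Suc N"
    by (metis not0_implies_Suc power_not_zero zero_neq_numeral)
  have "2 * trace (matpow M (2 ^ k)) = trace (matpow M N ** (2 *\<^sub>R M))"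
    by (simp add: N matpow_commute trace_mult_scaleR)
  also have "2 *\<^sub>R M = A + B"
    by (simp add: M_def)
  also have "trace (matpow M N ** (A + B)) = trace (matpow M N ** A) + trace (matpow M N ** B)"
    by (simp add: matrix_add_ldistrib trace_add)
  finally have eq: "trace (matpow M N ** A) + trace (matpow M N ** B) = 2 * trace (matpow M (2 ^ k))"
    by simp
  have young: "trace (matpow M N ** C) \<le>
      (1 - 1 / 2 ^ k) * trace (matpow M (2 ^ k)) + 1 / 2 ^ k * trace (matpow C (2 ^ k))"
    if "transpose C = C" for C
    using trace_matpow_young[OF that tM, of k k] by (simp add: N del: matpow.simps(2))
  have "0 < (1::real) / 2 ^ k"
    by simp
  moreover have "2 * t \<le> a + b" if "0 < c" "u + v = 2 * t" "u \<le> (1 - c) * t + c * a"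
    "v \<le> (1 - c) * t + c * b" for a b c t u v :: real
  proof -
    have "c * (2 * t) \<le> c * (a + b)"
      using that(2-) by (simp add: algebra_simps)
    then show ?thesis
      using that(1) by simp
  qed
  ultimately have "2 * trace (matpow M (2 ^ k)) \<le> trace (matpow A (2 ^ k)) + trace (matpow B (2 ^ k))"
    using eq young[OF tA] young[OF tB] by blast
  then show ?thesis
    by (simp add: M_def)
qed

section \<open>Quadratic forms and approximate exponentials\<close>

lemma symmetric_inner: "transpose A = A \<Longrightarrow> (A *v x) \<bullet> y = x \<bullet> (A *v (y :: real ^ 'p))"
  by (metis dot_lmul_matrix vector_transpose_matrix)

lemma transpose_add: "transpose (A + B) = transpose A + transpose B"
  by (simp add: transpose_def vec_eq_iff)

lemma transpose_diff: "transpose (A - B) = transpose A - transpose (B :: real ^ 'n ^ 'm)"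
  by (simp add: transpose_def vec_eq_iff)

lemma scaleR_matrix_vector: "(c *\<^sub>R A) *v x = c *\<^sub>R (A *v (x :: real ^ 'p))"
  by (simp add: scaleR_matrix_vector_assoc)

lemma power_two_power_Suc: "x ^ (2 ^ Suc k) = (x ^ (2 ^ k))\<^sup>2" for x :: "'a::monoid_mult"
  by (simp only: power_Suc2 power_mult)

text \<open>This is H^2 \<preceq> c H: positivity is evaluated at v - t H v, and the term cubic in H
  is bounded by \<open>le\<close> at H v. The choice t = 1/c minimizes the resulting quadratic in
  t.\<close>

lemma psd_norm_bound:
  fixes H :: "real ^ 'p ^ 'p"
  assumes sym: "transpose H = H" and pos: "\<And>v. 0 \<le> v \<bullet> (H *v v)"
    and le: "\<And>v. v \<bullet> (H *v v) \<le> c * (v \<bullet> v)" and "0 < c"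
  shows "(H *v v) \<bullet> (H *v v) \<le> c * (v \<bullet> (H *v v))"
proof -
  define t where "t = 1 / c"
  have "0 \<le> (v - t *\<^sub>R (H *v v)) \<bullet> (H *v (v - t *\<^sub>R (H *v v)))"
    by (rule pos)
  also have "\<dots> = v \<bullet> (H *v v) - 2 * t * ((H *v v) \<bullet> (H *v v)) + t\<^sup>2 * ((H *v v) \<bullet> (H *v (H *v v)))"
    using symmetric_inner[OF sym, of v "H *v v"]
    by (simp add: matrix_vector_mult_diff_distrib matrix_vector_mult_scaleR inner_diff_left
        inner_diff_right power2_eq_square algebra_simps)
  also have "t\<^sup>2 * ((H *v v) \<bullet> (H *v (H *v v))) \<le> t\<^sup>2 * (c * ((H *v v) \<bullet> (H *v v)))"
    by (intro mult_left_mono le) simp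
  also have "t\<^sup>2 * (c * ((H *v v) \<bullet> (H *v v))) = t * ((H *v v) \<bullet> (H *v v))"
    using \<open>0 < c\<close> by (simp add: t_def power2_eq_square)
  finally have "t * ((H *v v) \<bullet> (H *v v)) \<le> v \<bullet> (H *v v)"
    by simp
  then show ?thesis
    using \<open>0 < c\<close> by (simp add: t_def field_simps)
qed

lemma psd_norm_le:
  fixes H :: "real ^ 'p ^ 'p"
  assumes sym: "transpose H = H" and pos: "\<And>v. 0 \<le> v \<bullet> (H *v v)"
    and le: "\<And>v. v \<bullet> (H *v v) \<le> c * (v \<bullet> v)" and "0 < c"
  shows "norm (H *v v) \<le> c * norm v"
proof -
  have "(norm (H *v v))\<^sup>2 \<le> c * (c * (v \<bullet> v))"
    unfolding power2_norm_eq_inner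
    by (rule order_trans[OF psd_norm_bound[OF assms] mult_left_mono[OF le]]) (use \<open>0 < c\<close> in simp)
  then have "(norm (H *v v))\<^sup>2 \<le> (c * norm v)\<^sup>2"
    by (simp only: power_mult_distrib power2_norm_eq_inner) (simp add: power2_eq_square mult.assoc)
  then show ?thesis
    by (rule power2_le_imp_le) (use \<open>0 < c\<close> in auto)
qed

text \<open>A chord bound for \<open>z \<mapsto> (1 - z)\<^bsup>N\<^esup>\<close> on \<open>[0, r]\<close>, proved for matrices by repeated squaring
  of \<open>1 - W\<close>, using \<open>1 - (1 - W)\<^sup>2 = 2 W - W\<^sup>2\<close> and \<open>W\<^sup>2 \<preceq> w W\<close>.\<close>

lemma matpow_le_chord:
  fixes Z :: "real ^ 'p ^ 'p"
  assumes sym: "transpose Z = Z" and pos: "\<And>v. 0 \<le> v \<bullet> (Z *v v)"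
    and le: "\<And>v. v \<bullet> (Z *v v) \<le> r * (v \<bullet> v)" and r: "0 < r" "r \<le> 1"
  shows "v \<bullet> (matpow (mat 1 - Z) (2 ^ k) *v v) \<le>
    v \<bullet> v - (1 - (1 - r) ^ (2 ^ k)) / r * (v \<bullet> (Z *v v))"
proof -
  define B where "B k = matpow (mat 1 - Z) (2 ^ k)" for k
  define w where "w k = 1 - (1 - r) ^ (2 ^ k)" for k :: nat
  have symB: "transpose (B k) = B k" for k
    by (simp add: B_def transpose_matpow transpose_diff sym)
  have w: "0 < w k" "w k \<le> 1" for k
    using r power_le_one[of "1 - r" "2 ^ k"] power_less_one_iff[of "1 - r" "2 ^ k"]
    by (simp_all add: w_def)
  have B_Suc: "v \<bullet> (B (Suc k) *v v) = (B k *v v) \<bullet> (B k *v v)" for k v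
    by (simp add: B_def matpow_double flip: matrix_vector_mul_assoc)
       (simp add: symmetric_inner symB[unfolded B_def])
  have w_Suc: "w (Suc k) = (2 - w k) * w k" for k
    unfolding w_def power_two_power_Suc by (simp add: power2_eq_square algebra_simps)
  \<comment> \<open>The first conjunct is the chord bound. The second, W \<preceq> w I, is carried
    along because the next squaring needs W^2 \<preceq> w W.\<close>
  have "\<forall>v. w k / r * (v \<bullet> (Z *v v)) \<le> v \<bullet> v - v \<bullet> (B k *v v) \<and>
    v \<bullet> v - v \<bullet> (B k *v v) \<le> w k * (v \<bullet> v)" for k
  proof (induction k)
    case 0
    then show ?case
      using r le by (simp add: w_def B_def matrix_vector_mult_diff_rdistrib inner_diff_right)
  next
    case (Suc k)
    define W where "W = mat 1 - B k"
    have symW: "transpose W = W"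
      by (simp add: W_def transpose_diff symB)
    have Wv: "v \<bullet> (W *v v) = v \<bullet> v - v \<bullet> (B k *v v)" for v
      by (simp add: W_def matrix_vector_mult_diff_rdistrib inner_diff_right)
    have Wlow: "w k / r * (v \<bullet> (Z *v v)) \<le> v \<bullet> (W *v v)"
      and Wup: "v \<bullet> (W *v v) \<le> w k * (v \<bullet> v)" for v
      using Suc by (simp_all add: Wv)
    have Wpos: "0 \<le> v \<bullet> (W *v v)" for v
      by (rule order_trans[OF _ Wlow])
         (intro mult_nonneg_nonneg divide_nonneg_nonneg pos less_imp_le[OF w(1)] less_imp_le[OF r(1)])
    show ?case
    proof (intro allI conjI)
      fix v
      have "(B k *v v) \<bullet> (B k *v v) = v \<bullet> v - 2 * (v \<bullet> (W *v v)) + (W *v v) \<bullet> (W *v v)"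
        by (simp add: W_def matrix_vector_mult_diff_rdistrib inner_diff_left inner_diff_right
            inner_commute)
      then have "v \<bullet> v - v \<bullet> (B (Suc k) *v v) \<ge> (2 - w k) * (v \<bullet> (W *v v))"
        using psd_norm_bound[OF symW Wpos Wup, of v] w[of k]
        by (simp add: B_Suc algebra_simps)
      moreover have "(2 - w k) * (v \<bullet> (W *v v)) \<ge> (2 - w k) * (w k / r * (v \<bullet> (Z *v v)))"
        using w[of k] by (intro mult_left_mono Wlow) auto
      ultimately show "w (Suc k) / r * (v \<bullet> (Z *v v)) \<le> v \<bullet> v - v \<bullet> (B (Suc k) *v v)"
        by (simp add: w_Suc)
      \<comment> \<open>Cauchy--Schwarz turns the lower bound on v . B v into one on |B v|, and |B
        v|^2 is the quadratic form of the next power.\<close>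
      have "(1 - w k) * (v \<bullet> v) \<le> v \<bullet> (B k *v v)"
        using Wup[of v] by (simp add: Wv algebra_simps)
      also have "\<dots> \<le> norm v * norm (B k *v v)"
        by (rule norm_cauchy_schwarz)
      finally have "norm v * ((1 - w k) * norm v) \<le> norm v * norm (B k *v v)"
        by (simp add: power2_norm_eq_inner[symmetric] power2_eq_square algebra_simps)
      then have "(1 - w k) * norm v \<le> norm (B k *v v)"
        by (cases "v = 0") auto
      then have "((1 - w k) * norm v)\<^sup>2 \<le> (norm (B k *v v))\<^sup>2"
        using w[of k] by (intro power_mono) auto
      then have "(1 - w k)\<^sup>2 * (v \<bullet> v) \<le> (B k *v v) \<bullet> (B k *v v)"
        by (simp add: power_mult_distrib power2_norm_eq_inner)
      then show "v \<bullet> v - v \<bullet> (B (Suc k) *v v) \<le> w (Suc k) * (v \<bullet> v)"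
        by (simp add: w_Suc B_Suc power2_eq_square algebra_simps)
    qed
  qed
  then show ?thesis
    unfolding B_def w_def by (smt (verit))
qed

lemma trace_eq_sum_axis: "trace A = (\<Sum>j\<in>UNIV. axis j 1 \<bullet> (A *v axis j (1::real)))"
  by (simp add: trace_def inner_axis' matrix_vector_mult_basis column_def)

text \<open>Rewrites a trace as a sum of quadratic forms of \<open>B\<close>, so that bounds on
  quadratic forms can be applied under the trace.\<close>

lemma trace_sandwich:
  fixes B T :: "real ^ 'p ^ 'p"
  assumes "transpose T = T"
  shows "trace (T ** T ** B) = (\<Sum>j\<in>UNIV. (T *v axis j 1) \<bullet> (B *v (T *v axis j 1)))"
proof -
  have "trace (T ** T ** B) = trace (T ** B ** T)"
    using trace_mul_sym[of T "T ** B"] by (simp add: matrix_mul_assoc)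
  then show ?thesis
    by (simp add: trace_eq_sum_axis symmetric_inner[OF assms] flip: matrix_vector_mul_assoc)
qed

lemma norm_matrix_vector_le: "norm (A *v v) \<le> norm A * norm (v :: real ^ 'p)"
  for A :: "real ^ 'p ^ 'q"
proof -
  have "(norm (A *v v))\<^sup>2 = (\<Sum>i\<in>UNIV. (A $ i \<bullet> v)\<^sup>2)"
    unfolding power2_norm_eq_inner
    by (subst inner_vec_def) (simp add: matrix_vector_mul_component power2_eq_square)
  also have "\<dots> \<le> (\<Sum>i\<in>UNIV. (A $ i \<bullet> A $ i) * (v \<bullet> v))"
    by (intro sum_mono Cauchy_Schwarz_ineq)
  also have "\<dots> = (norm A * norm v)\<^sup>2"
    unfolding power_mult_distrib power2_norm_eq_inner sum_distrib_right[symmetric]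
    by (subst (2) inner_vec_def) simp
  finally show ?thesis
    by (rule power2_le_imp_le) simp
qed

text \<open>Stands in for the bound of the trace by a power of the largest eigenvalue. For a unit
  vector, v . B^(2i) v = |B^i v|^2 is at least the square of v . B^i v, so the bound survives every
  squaring. The last squaring passes to the Frobenius norm of B^(N/2), whose square is the trace;
  this is where k > 0 enters.\<close>

lemma trace_matpow_ge:
  fixes B :: "real ^ 'p ^ 'p"
  assumes sym: "transpose B = B" and v: "norm v = 1" and c: "0 \<le> c" "c \<le> v \<bullet> (B *v v)" and "0 < k"
  shows "c ^ (2 ^ k) \<le> trace (matpow B (2 ^ k))"
proof -
  have symB: "transpose (matpow B i) = matpow B i" for i
    by (simp add: transpose_matpow sym)
  have nrm: "c ^ (2 ^ i) \<le> norm (matpow B (2 ^ i) *v v)" if "c ^ (2 ^ i) \<le> v \<bullet> (matpow B (2 ^ i) *v v)" for i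
    using that norm_cauchy_schwarz[of v "matpow B (2 ^ i) *v v"] v by simp
  have *: "c ^ (2 ^ i) \<le> v \<bullet> (matpow B (2 ^ i) *v v)" for i
  proof (induction i)
    case (Suc i)
    have "c ^ (2 ^ Suc i) = (c ^ (2 ^ i))\<^sup>2"
      by (rule power_two_power_Suc)
    also have "\<dots> \<le> (norm (matpow B (2 ^ i) *v v))\<^sup>2"
      using nrm[OF Suc] c by (intro power_mono) auto
    also have "\<dots> = v \<bullet> (matpow B (2 ^ Suc i) *v v)"
      by (simp add: power2_norm_eq_inner matpow_double symmetric_inner[OF symB] flip: matrix_vector_mul_assoc)
    finally show ?case .
  qed (use c in simp)
  obtain i where k: "k = Suc i"
    using \<open>0 < k\<close> by (cases k) auto
  have "c ^ (2 ^ k) = (c ^ (2 ^ i))\<^sup>2"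
    unfolding k by (rule power_two_power_Suc)
  also have "\<dots> \<le> (norm (matpow B (2 ^ i) *v v))\<^sup>2"
    using nrm[OF *[of i]] c by (intro power_mono) auto
  also have "\<dots> \<le> (norm (matpow B (2 ^ i)))\<^sup>2"
    using norm_matrix_vector_le[of "matpow B (2 ^ i)" v] v by (intro power_mono) auto
  also have "\<dots> = trace (matpow B (2 ^ k))"
    by (simp add: power2_norm_eq_inner inner_matrix_eq_trace symB k matpow_double)
  finally show ?thesis .
qed

lemma norm_matpow_le:
  assumes "\<And>v. norm (Y *v v) \<le> a * norm v" "0 \<le> a"
  shows "norm (matpow Y j *v v) \<le> a ^ j * norm v"
proof (induction j)
  case (Suc j)
  have "norm (matpow Y (Suc j) *v v) \<le> a * norm (matpow Y j *v v)"
    using assms by (simp flip: matrix_vector_mul_assoc)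
  also have "\<dots> \<le> a * (a ^ j * norm v)"
    by (intro mult_left_mono Suc assms)
  finally show ?case
    by (simp add: mult_ac)
qed simp

text \<open>Telescoping: X^(j+1) - Y^(j+1) = X (X^j - Y^j) + (X - Y) Y^j. The assumption
  \<open>1 \<le> a\<close> allows rounding a^j up to a^(j+1) in the second term.\<close>

lemma norm_matpow_diff_le:
  assumes X: "\<And>v. norm (X *v v) \<le> a * norm v" and Y: "\<And>v. norm (Y *v v) \<le> a * norm v"
    and XY: "\<And>v. norm (X *v v - Y *v v) \<le> b * norm v" and a: "1 \<le> a" and b: "0 \<le> b"
  shows "norm (matpow X j *v v - matpow Y j *v v) \<le> real j * a ^ j * b * norm v"
proof (induction j)
  case (Suc j)
  define x y where "x = matpow X j *v v" and "y = matpow Y j *v v"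
  have "norm (matpow X (Suc j) *v v - matpow Y (Suc j) *v v) = norm (X *v (x - y) + (X *v y - Y *v y))"
    by (simp add: x_def y_def matrix_vector_mult_diff_distrib flip: matrix_vector_mul_assoc)
  also have "\<dots> \<le> a * norm (x - y) + b * norm y"
    by (intro norm_triangle_mono X XY)
  also have "\<dots> \<le> a * (real j * a ^ j * b * norm v) + b * (a ^ j * norm v)"
    unfolding x_def y_def using a b by (intro add_mono mult_left_mono Suc norm_matpow_le Y) auto
  also have "b * (a ^ j * norm v) \<le> b * (a ^ Suc j * norm v)"
    using a b by (intro mult_left_mono mult_right_mono power_increasing) auto
  finally show ?case
    by (simp add: algebra_simps)
qed simp

lemma trace_matpow_diff_le:
  fixes X Y :: "real ^ 'p ^ 'p"
  assumes X: "\<And>v. norm (X *v v) \<le> a * norm v" and Y: "\<And>v. norm (Y *v v) \<le> a * norm v"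
    and XY: "\<And>v. norm (X *v v - Y *v v) \<le> b * norm v" and a: "1 \<le> a" and b: "0 \<le> b"
  shows "trace (matpow X j) \<le> trace (matpow Y j) + real CARD('p) * (real j * a ^ j * b)"
proof -
  have "trace (matpow X j) - trace (matpow Y j) =
      (\<Sum>i\<in>UNIV. axis i 1 \<bullet> (matpow X j *v axis i 1 - matpow Y j *v axis i (1::real)))"
    by (simp add: trace_eq_sum_axis inner_diff_right sum_subtractf)
  also have "\<dots> \<le> (\<Sum>i\<in>(UNIV :: 'p set). real j * a ^ j * b)"
  proof (rule sum_mono)
    fix i :: 'p
    let ?e = "axis i (1::real)"
    have "?e \<bullet> (matpow X j *v ?e - matpow Y j *v ?e) \<le> norm ?e * norm (matpow X j *v ?e - matpow Y j *v ?e)"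
      by (rule norm_cauchy_schwarz)
    also have "\<dots> \<le> real j * a ^ j * b"
      using norm_matpow_diff_le[OF assms, of j ?e] by simp
    finally show "?e \<bullet> (matpow X j *v ?e - matpow Y j *v ?e) \<le> real j * a ^ j * b" .
  qed
  finally show ?thesis
    by simp
qed

definition approx_exp :: "nat \<Rightarrow> real ^ 'p ^ 'p \<Rightarrow> real ^ 'p ^ 'p" where
  "approx_exp k A = matpow (mat 1 + (1 / 2 ^ k) *\<^sub>R A) (2 ^ k)"

text \<open>The factors I + (S + A) / N and (I + S / N) (I + A / N) differ by exactly S A / N^2.
  Raising to the power N costs a further factor N, the norms staying below exp (s + t), so the error
  is O(1/N). The trace of the power of the product is then split by
  \<open>trace_matpow_mult_le\<close>.\<close>

lemma trace_approx_exp_add_le: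
  fixes S A :: "real ^ 'p ^ 'p"
  assumes symS: "transpose S = S" and symA: "transpose A = A"
    and S: "\<And>v. norm (S *v v) \<le> s * norm v" and A: "\<And>v. norm (A *v v) \<le> t * norm v"
    and st: "0 \<le> s" "0 \<le> t"
  shows "trace (approx_exp k (S + A)) \<le> trace (approx_exp k S ** approx_exp k A) +
    real CARD('p) * (exp (s + t) * s * t) / 2 ^ k"
proof -
  define c :: real where "c = 1 / 2 ^ k"
  have c: "0 \<le> c"
    by (simp add: c_def)
  have one_add: "norm (v + c *\<^sub>R u) \<le> exp (c * d) * norm v" if "norm u \<le> d * norm v" for u v :: "real ^ 'p" and d
  proof -
    have "norm (v + c *\<^sub>R u) \<le> norm v + c * norm u"
      using norm_triangle_ineq[of v "c *\<^sub>R u"] c by simp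
    also have "\<dots> \<le> norm v + c * (d * norm v)"
      using c that by (intro add_left_mono mult_left_mono)
    also have "\<dots> = (1 + c * d) * norm v"
      by (simp add: algebra_simps)
    also have "\<dots> \<le> exp (c * d) * norm v"
      by (intro mult_right_mono exp_ge_add_one_self) auto
    finally show ?thesis .
  qed
  define X Y where "X = mat 1 + c *\<^sub>R (S + A)" and "Y = (mat 1 + c *\<^sub>R S) ** (mat 1 + c *\<^sub>R A)"
  have X: "norm (X *v v) \<le> exp (c * (s + t)) * norm v" for v
    using one_add[of "(S + A) *v v" "s + t" v] norm_triangle_mono[OF S[of v] A[of v]]
    by (simp add: X_def matrix_vector_mult_add_rdistrib scaleR_matrix_vector algebra_simps)
  have Y_eq: "Y *v v = (v + c *\<^sub>R (A *v v)) + c *\<^sub>R (S *v (v + c *\<^sub>R (A *v v)))" for v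
    by (simp add: Y_def matrix_vector_mult_add_rdistrib scaleR_matrix_vector flip: matrix_vector_mul_assoc)
  have Y: "norm (Y *v v) \<le> exp (c * (s + t)) * norm v" for v
  proof -
    have "norm (Y *v v) \<le> exp (c * s) * norm (v + c *\<^sub>R (A *v v))"
      unfolding Y_eq by (rule one_add[OF S])
    also have "\<dots> \<le> exp (c * s) * (exp (c * t) * norm v)"
      by (intro mult_left_mono one_add A) auto
    finally show ?thesis
      by (simp add: exp_add algebra_simps)
  qed
  have XY: "norm (X *v v - Y *v v) \<le> (c\<^sup>2 * s * t) * norm v" for v
  proof -
    have "X *v v - Y *v v = - (c\<^sup>2 *\<^sub>R (S *v (A *v v)))"
      by (simp add: Y_eq X_def matrix_vector_mult_add_rdistrib scaleR_matrix_vector power2_eq_square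
          matrix_vector_right_distrib matrix_vector_mult_scaleR scaleR_add_right)
    then have "norm (X *v v - Y *v v) = c\<^sup>2 * norm (S *v (A *v v))"
      by simp
    also have "\<dots> \<le> c\<^sup>2 * (s * (t * norm v))"
      using st by (intro mult_left_mono order_trans[OF S] A) auto
    finally show ?thesis
      by (simp add: mult_ac)
  qed
  have "trace (matpow X (2 ^ k)) \<le> trace (matpow Y (2 ^ k)) +
      real CARD('p) * (real (2 ^ k) * exp (c * (s + t)) ^ (2 ^ k) * (c\<^sup>2 * s * t))"
    by (rule trace_matpow_diff_le) (use X Y XY st c in auto)
  also have "exp (c * (s + t)) ^ (2 ^ k) = exp (s + t)"
    by (simp add: exp_of_nat_mult[symmetric] c_def)
  also have "real CARD('p) * (real (2 ^ k) * exp (s + t) * (c\<^sup>2 * s * t)) =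
      real CARD('p) * (exp (s + t) * s * t) / 2 ^ k"
    by (simp add: c_def power2_eq_square)
  also have "trace (matpow Y (2 ^ k)) \<le> trace (approx_exp k S ** approx_exp k A)"
    unfolding Y_def approx_exp_def c_def
    by (rule trace_matpow_mult_le) (simp_all add: transpose_add transpose_scalar symS symA)
  finally show ?thesis
    by (simp add: X_def approx_exp_def c_def)
qed

section \<open>A matrix Chernoff bound for both sampling schemes\<close>

lemma transpose_zero [simp]: "transpose 0 = (0 :: real ^ 'n ^ 'm)"
  by (simp add: transpose_def vec_eq_iff)

lemma transpose_uminus: "transpose (- A) = - transpose (A :: real ^ 'n ^ 'm)"
  by (simp add: transpose_def vec_eq_iff)

lemma uminus_matrix_vector: "(- A) *v x = - (A *v (x :: real ^ 'p))"
  using scaleR_matrix_vector[of "- 1" A x] by simp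

lemma sum_list_matrix_vector:
  "(\<Sum>j\<leftarrow>L. X j) *v v = (\<Sum>j\<leftarrow>L. X j *v (v :: real ^ 'p))"
  by (induction L) (simp_all add: matrix_vector_mult_add_rdistrib)

lemma matpow_mat_1 [simp]: "matpow (mat 1) n = mat 1"
  by (induction n) simp_all

lemma inner_sum_list_right: "v \<bullet> (\<Sum>j\<leftarrow>L. f j) = (\<Sum>j\<leftarrow>L. v \<bullet> f j)"
  by (induction L) (simp_all add: inner_add_right)

lemma transpose_sum_list:
  assumes "\<And>j. j \<in> set L \<Longrightarrow> transpose (X j) = (X j :: real ^ 'p ^ 'p)"
  shows "transpose (\<Sum>j\<leftarrow>L. X j) = (\<Sum>j\<leftarrow>L. X j)"
  using assms
  by (induction L) (simp_all add: transpose_add)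

lemma sum_list_map_update:
  fixes X :: "'i \<Rightarrow> 'a :: ab_group_add"
  assumes "a < length L"
  shows "(\<Sum>i\<leftarrow>L[a := j]. X i) = (\<Sum>i\<leftarrow>L. X i) + X j - X (L ! a)"
  using assms
proof (induction L arbitrary: a)
  case (Cons i L)
  then show ?case
    by (cases a) (simp_all add: algebra_simps)
qed simp

section \<open>Enumeration of samples and comparison of the two sampling schemes\<close>

lemma finite_samples [simp]: "finite (samples md n m)"
proof (rule finite_subset)
  show "samples md n m \<subseteq> {L. set L \<subseteq> {1..n} \<and> length L = m}"
    by (cases md) auto
qed (simp add: finite_lists_length_eq)

lemma set_samples_subset: "L \<in> samples md n m \<Longrightarrow> set L \<subseteq> {1..n}"
  by (cases md) auto

lemma length_samples: "L \<in> samples md n m \<Longrightarrow> length L = m"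
  by (cases md) auto

lemma sum_samples_with_Suc:
  "(\<Sum>L\<in>samples With_Replacement n (Suc l). h L) =
    (\<Sum>L\<in>samples With_Replacement n l. \<Sum>i\<in>{1..n}. h (i # L))"
proof -
  have "samples With_Replacement n (Suc l) =
      (\<lambda>(L, i). i # L) ` (samples With_Replacement n l \<times> {1..n})"
    by (auto simp: length_Suc_conv image_iff)
  then show ?thesis
    by (simp add: sum.reindex inj_on_def sum.cartesian_product case_prod_unfold del: samples.simps)
qed

lemma sum_samples_without_Suc:
  "(\<Sum>L\<in>samples Without_Replacement n (Suc l). h L) =
    (\<Sum>L\<in>samples Without_Replacement n l. \<Sum>i\<in>{1..n} - set L. h (i # L))"
proof -
  have "samples Without_Replacement n (Suc l) =
      (\<lambda>(L, i). i # L) ` (SIGMA L:samples Without_Replacement n l. {1..n} - set L)"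
    by (auto simp: length_Suc_conv image_iff)
  then show ?thesis
    by (simp add: sum.reindex inj_on_def sum.Sigma case_prod_unfold del: samples.simps)
qed

lemma card_samples_with: "card (samples With_Replacement n m) = n ^ m"
  using card_lists_length_eq[of "{1..n}" m] by (simp add: conj_commute)

lemma samples_0: "samples md n 0 = {[]}"
  by (cases md) auto

lemma card_complement_set_sample:
  assumes "L \<in> samples Without_Replacement n k"
  shows "card ({1..n} - set L) = n - k"
proof -
  have "card (set L) = k" "set L \<subseteq> {1..n}"
    using assms by (auto simp: distinct_card)
  then show ?thesis
    by (simp add: card_Diff_subset)
qed

lemma card_samples_without_Suc:
  "card (samples Without_Replacement n (Suc k)) = (n - k) * card (samples Without_Replacement n k)"
proof -
  have "card (samples Without_Replacement n (Suc k)) =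
      (\<Sum>L\<in>samples Without_Replacement n k. card ({1..n} - set L))"
    using sum_samples_without_Suc[of "\<lambda>_. 1 :: nat" n k] by (simp del: samples.simps)
  also have "\<dots> = (\<Sum>L\<in>samples Without_Replacement n k. n - k)"
    by (intro sum.cong refl card_complement_set_sample)
  finally show ?thesis
    by (simp del: samples.simps)
qed

lemma card_samples_pos:
  assumes "1 \<le> n" and "md = Without_Replacement \<Longrightarrow> m \<le> n"
  shows "0 < card (samples md n m)"
proof (cases md)
  case With_Replacement
  then show ?thesis
    using assms by (simp add: card_samples_with del: samples.simps)
next
  case Without_Replacement
  have "k \<le> n \<Longrightarrow> 0 < card (samples Without_Replacement n k)" for k
    by (induction k) (simp_all add: samples_0 card_samples_without_Suc del: samples.simps)
  then show ?thesis
    using assms Without_Replacement by blast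
qed

text \<open>Exchanging an element of the sample with a new index is an involution, and the sum of the sample
  extended by the new index is the midpoint of the two sums in which the old, respectively the new
  index is counted twice.\<close>

lemma sum_samples_without_swap:
  fixes X :: "nat \<Rightarrow> 'a :: real_vector" and g :: "'a \<Rightarrow> real"
  assumes V: "subspace V" "\<And>i. i \<in> {1..n} \<Longrightarrow> X i \<in> V"
    and g: "\<And>a b. a \<in> V \<Longrightarrow> b \<in> V \<Longrightarrow> g ((1/2) *\<^sub>R (a + b)) \<le> (g a + g b) / 2"
    and "k \<le> n"
  shows "real n * (\<Sum>L\<in>samples Without_Replacement n (Suc k). g (\<Sum>j\<leftarrow>L. X j)) \<le>
    real (n - k) * (\<Sum>L\<in>samples Without_Replacement n k. \<Sum>i\<in>{1..n}. g (X i + (\<Sum>j\<leftarrow>L. X j)))"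
proof -
  define D where "D = samples Without_Replacement n k"
  define S where "S L = (\<Sum>j\<leftarrow>L. X j)" for L
  define T where "T = (\<Sum>L\<in>D. \<Sum>i\<in>{1..n} - set L. g (X i + S L))"
  define U where "U = (\<Sum>L\<in>D. \<Sum>i\<in>set L. g (X i + S L))"
  \<comment> \<open>A sample, a position in it and an index outside it. Both sums lift to this set:
    the terms of \<open>T\<close> ignore the position, giving the factor k, and those of
    \<open>U\<close> ignore the outside index, giving n - k.\<close>
  define Tr where "Tr = (SIGMA L:D. {..<k} \<times> ({1..n} - set L))"
  have D: "length L = k" "set L \<subseteq> {1..n}" "distinct L" if "L \<in> D" for L
    using that by (auto simp: D_def)
  have SV: "S L \<in> V" if "set L \<subseteq> {1..n}" for L
    using that V by (induction L) (auto simp: S_def subspace_0 subspace_add)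
  have "real k * T = (\<Sum>L\<in>D. \<Sum>(a, j)\<in>{..<k} \<times> ({1..n} - set L). g (X j + S L))"
    by (simp add: T_def sum_distrib_left sum.cartesian_product[symmetric])
  then have kT: "real k * T = (\<Sum>(L, a, j)\<in>Tr. g (X j + S L))"
    by (simp add: Tr_def sum.Sigma D_def del: samples.simps)
  have "real (n - k) * U = (\<Sum>L\<in>D. \<Sum>(a, j)\<in>{..<k} \<times> ({1..n} - set L). g (X (L ! a) + S L))"
    unfolding U_def sum_distrib_left
  proof (rule sum.cong)
    fix L assume L: "L \<in> D"
    have "bij_betw (\<lambda>a. L ! a) {..<k} (set L)"
      using D[OF L] by (simp add: bij_betw_nth)
    from sum.reindex_bij_betw[OF this, of "\<lambda>i. g (X i + S L)", symmetric]
    show "(\<Sum>i\<in>set L. real (n - k) * g (X i + S L)) =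
        (\<Sum>(a, j)\<in>{..<k} \<times> ({1..n} - set L). g (X (L ! a) + S L))"
      using card_complement_set_sample[of L n k] L
      by (simp add: sum_distrib_left[symmetric] sum.cartesian_product[symmetric] D_def
          del: samples.simps)
  qed simp
  then have nU: "real (n - k) * U = (\<Sum>(L, a, j)\<in>Tr. g (X (L ! a) + S L))"
    by (simp add: Tr_def sum.Sigma D_def del: samples.simps)
  also have "\<dots> = (\<Sum>(L, a, j)\<in>Tr. g (X j + S (L[a := j])))"
  proof (rule sum.reindex_bij_witness[where i = "\<lambda>(L, a, j). (L[a := j], a, L ! a)"
        and j = "\<lambda>(L, a, j). (L[a := j], a, L ! a)"])
    fix z assume "z \<in> Tr"
    then obtain L a j where z: "z = (L, a, j)" and L: "L \<in> D" and a: "a < k"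
      and j: "j \<in> {1..n}" "j \<notin> set L"
      by (auto simp: Tr_def)
    note DL = D[OF L]
    show "(case case z of (L, a, j) \<Rightarrow> (L[a := j], a, L ! a) of (L, a, j) \<Rightarrow> (L[a := j], a, L ! a)) = z"
      using DL a by (simp add: z)
    then show "(case case z of (L, a, j) \<Rightarrow> (L[a := j], a, L ! a) of (L, a, j) \<Rightarrow> (L[a := j], a, L ! a)) = z" .
    have "L[a := j] \<in> D"
      using DL a j set_update_subset_insert[of L a j]
      by (auto simp: D_def distinct_list_update)
    moreover have "L ! a \<notin> set (L[a := j])"
      using DL a j by (auto simp: in_set_conv_nth nth_list_update nth_eq_iff_index_eq split: if_splits)
    moreover have "L ! a \<in> {1..n}"
      using DL a nth_mem by blast
    ultimately show "(case z of (L, a, j) \<Rightarrow> (L[a := j], a, L ! a)) \<in> Tr"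
      using a by (simp add: z Tr_def)
    then show "(case z of (L, a, j) \<Rightarrow> (L[a := j], a, L ! a)) \<in> Tr" .
    show "(case case z of (L, a, j) \<Rightarrow> (L[a := j], a, L ! a) of (L, a, j) \<Rightarrow> g (X j + S (L[a := j]))) =
        (case z of (L, a, j) \<Rightarrow> g (X (L ! a) + S L))"
      using DL a by (simp add: z)
  qed
  finally have nU': "real (n - k) * U = (\<Sum>(L, a, j)\<in>Tr. g (X j + S (L[a := j])))" .
  have "real k * T \<le> (\<Sum>(L, a, j)\<in>Tr. (g (X (L ! a) + S L) + g (X j + S (L[a := j]))) / 2)"
    unfolding kT
  proof (rule sum_mono, clarify)
    fix L a j assume "(L, a, j) \<in> Tr"
    then have L: "L \<in> D" and a: "a < k" and j: "j \<in> {1..n}" "j \<notin> set L"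
      by (auto simp: Tr_def)
    note DL = D[OF L]
    have upd: "S (L[a := j]) = S L + X j - X (L ! a)"
      using DL a by (simp add: S_def sum_list_map_update)
    have "X (L ! a) \<in> V"
      using DL a by (intro V(2)) (use nth_mem in blast)
    moreover have "S (L[a := j]) \<in> V"
      using DL j by (intro SV order_trans[OF set_update_subset_insert]) auto
    ultimately have "g ((1/2) *\<^sub>R ((X (L ! a) + S L) + (X j + S (L[a := j])))) \<le>
        (g (X (L ! a) + S L) + g (X j + S (L[a := j]))) / 2"
      using V(1) V(2)[OF j(1)] SV[OF DL(2)] by (intro g subspace_add)
    also have "(X (L ! a) + S L) + (X j + S (L[a := j])) = 2 *\<^sub>R (X j + S L)"
      by (simp add: upd scaleR_2)
    finally show "g (X j + S L) \<le> (g (X (L ! a) + S L) + g (X j + S (L[a := j]))) / 2"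
      by simp
  qed
  also have "\<dots> = (real (n - k) * U + real (n - k) * U) / 2"
    by (subst (1) nU, subst (1) nU')
       (simp add: sum.distrib[symmetric] sum_divide_distrib case_prod_unfold)
  also have "\<dots> = real (n - k) * U"
    by simp
  finally have "real k * T \<le> real (n - k) * U" .
  moreover have "(\<Sum>L\<in>D. \<Sum>i\<in>{1..n}. g (X i + S L)) = T + U"
    unfolding T_def U_def sum.distrib[symmetric]
    by (intro sum.cong refl sum.subset_diff D(2)) auto
  moreover have "(\<Sum>L\<in>samples Without_Replacement n (Suc k). g (S L)) = T"
    by (simp add: sum_samples_without_Suc T_def D_def S_def del: samples.simps)
  \<comment> \<open>Adding (n - k) T to both sides of k T \<le> (n - k) U gives n T \<le> (n - k) (T
    + U).\<close>
  ultimately show ?thesis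
    using \<open>k \<le> n\<close> by (simp add: S_def D_def of_nat_diff algebra_simps del: samples.simps)
qed

text \<open>Hoeffding's comparison of sampling without and with replacement, cleared of denominators.\<close>

lemma sum_samples_without_le_with:
  fixes X :: "nat \<Rightarrow> 'a :: real_vector" and g :: "'a \<Rightarrow> real"
  assumes V: "subspace V" "\<And>i. i \<in> {1..n} \<Longrightarrow> X i \<in> V"
    and g: "\<And>a b. a \<in> V \<Longrightarrow> b \<in> V \<Longrightarrow> g ((1/2) *\<^sub>R (a + b)) \<le> (g a + g b) / 2"
    and "m \<le> n"
  shows "real n ^ m * (\<Sum>L\<in>samples Without_Replacement n m. g (\<Sum>j\<leftarrow>L. X j)) \<le>
    real (card (samples Without_Replacement n m)) *
      (\<Sum>L\<in>samples With_Replacement n m. g (\<Sum>j\<leftarrow>L. X j))"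
  using g \<open>m \<le> n\<close>
proof (induction m arbitrary: g)
  case 0
  then show ?case
    by (simp add: samples_0 del: samples.simps)
next
  case (Suc k)
  let ?D = "samples Without_Replacement n" and ?W = "samples With_Replacement n"
  \<comment> \<open>The induction hypothesis is used for the translate of \<open>g\<close> by
    \<open>X i\<close>, which is again midpoint convex on \<open>V\<close>; hence \<open>g\<close>
    is generalized in the induction.\<close>
  have IH: "real n ^ k * (\<Sum>L\<in>?D k. g (X i + (\<Sum>j\<leftarrow>L. X j))) \<le>
      real (card (?D k)) * (\<Sum>L\<in>?W k. g (X i + (\<Sum>j\<leftarrow>L. X j)))" if i: "i \<in> {1..n}" for i
  proof (rule Suc.IH)
    fix a b assume ab: "a \<in> V" "b \<in> V"
    have "g ((1/2) *\<^sub>R ((X i + a) + (X i + b))) \<le> (g (X i + a) + g (X i + b)) / 2"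
      using ab i V by (intro Suc.prems subspace_add) auto
    also have "(1/2) *\<^sub>R ((X i + a) + (X i + b)) = X i + (1/2) *\<^sub>R (a + b)"
      by (simp add: scaleR_right_distrib algebra_simps flip: scaleR_left_distrib)
    finally show "g (X i + (1/2) *\<^sub>R (a + b)) \<le> (g (X i + a) + g (X i + b)) / 2" .
  qed (use Suc.prems in simp)
  have "real n ^ Suc k * (\<Sum>L\<in>?D (Suc k). g (\<Sum>j\<leftarrow>L. X j)) =
      real n ^ k * (real n * (\<Sum>L\<in>?D (Suc k). g (\<Sum>j\<leftarrow>L. X j)))"
    by simp
  also have "\<dots> \<le> real n ^ k * (real (n - k) * (\<Sum>L\<in>?D k. \<Sum>i\<in>{1..n}. g (X i + (\<Sum>j\<leftarrow>L. X j))))"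
    using V Suc.prems by (intro mult_left_mono sum_samples_without_swap) auto
  also have "\<dots> = real (n - k) * (\<Sum>i\<in>{1..n}. real n ^ k * (\<Sum>L\<in>?D k. g (X i + (\<Sum>j\<leftarrow>L. X j))))"
    by (subst sum.swap) (simp only: sum_distrib_left mult.left_commute)
  also have "\<dots> \<le> real (n - k) * (\<Sum>i\<in>{1..n}. real (card (?D k)) * (\<Sum>L\<in>?W k. g (X i + (\<Sum>j\<leftarrow>L. X j))))"
    by (intro mult_left_mono sum_mono IH) auto
  also have "\<dots> = real (card (?D (Suc k))) * (\<Sum>L\<in>?W k. \<Sum>i\<in>{1..n}. g (X i + (\<Sum>j\<leftarrow>L. X j)))"
    by (subst sum.swap[where A = "?W k"])
       (simp add: card_samples_without_Suc sum_distrib_left mult.assoc del: samples.simps)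
  finally show ?case
    by (simp only: sum_samples_with_Suc) (simp del: samples.simps)
qed


text \<open>Abstracts the Hessians of the \<open>f i\<close> at the current point: \<open>R\<close>
  stands for the largest \<open>Ks i\<close>, and \<open>mean_ge\<close> for strong convexity of the
  objective.\<close>

locale bounded_psd_family =
  fixes X :: "nat \<Rightarrow> real ^ 'p ^ 'p" and n :: nat and R \<gamma> :: real
  assumes n: "1 \<le> n"
    and sym: "\<And>i. i \<in> {1..n} \<Longrightarrow> transpose (X i) = X i"
    and pos: "\<And>i v. i \<in> {1..n} \<Longrightarrow> 0 \<le> v \<bullet> (X i *v v)"
    and le: "\<And>i v. i \<in> {1..n} \<Longrightarrow> v \<bullet> (X i *v v) \<le> R * (v \<bullet> v)"
    and mean_ge: "\<And>v. real n * \<gamma> * (v \<bullet> v) \<le> (\<Sum>i\<in>{1..n}. v \<bullet> (X i *v v))"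
    and \<gamma>: "0 < \<gamma>"
begin

lemma \<gamma>_le_R: "\<gamma> \<le> R"
proof -
  obtain v :: "real ^ 'p" where v: "v \<bullet> v = 1"
    using norm_axis_1 by (metis norm_eq_1)
  have "real n * \<gamma> \<le> (\<Sum>i\<in>{1..n}. v \<bullet> (X i *v v))"
    using mean_ge[of v] v by simp
  also have "\<dots> \<le> (\<Sum>i\<in>{1..n}. R)"
    using le[of _ v] v by (intro sum_mono) simp
  finally show ?thesis
    using n by simp
qed

lemma R: "0 < R"
  using \<gamma> \<gamma>_le_R by simp

text \<open>The minus sign serves the lower tail: a direction in which \<open>S\<close> has a small
  quadratic form makes the potential large.\<close>

definition potential :: "nat \<Rightarrow> real \<Rightarrow> real ^ 'p ^ 'p \<Rightarrow> real" where
  "potential k \<theta> S = trace (approx_exp k (- (\<theta> *\<^sub>R S)))"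

text \<open>The mean factor gained per draw: the chord of z \<mapsto> (1 - z)^N over
  [0, \<theta> R / N], evaluated at z = \<theta> \<gamma> / N, with N = 2^k. It tends to 1 - (1 -
  exp (- \<theta> R)) \<gamma> / R.\<close>

definition rate :: "nat \<Rightarrow> real \<Rightarrow> real" where
  "rate k \<theta> = 1 - (1 - (1 - \<theta> * R / 2 ^ k) ^ (2 ^ k)) * \<gamma> / R"

lemma rate_bounds:
  assumes "0 < \<theta>" "\<theta> * R \<le> 2 ^ k"
  shows "0 \<le> rate k \<theta>" "rate k \<theta> \<le> 1"
proof -
  define w where "w = 1 - (1 - \<theta> * R / 2 ^ k) ^ (2 ^ k)"
  have "0 \<le> 1 - \<theta> * R / 2 ^ k" "1 - \<theta> * R / 2 ^ k \<le> 1"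
    using assms R by simp_all
  then have w: "0 \<le> w" "w \<le> 1"
    unfolding w_def by (simp_all add: power_le_one)
  then show "rate k \<theta> \<le> 1"
    using R \<gamma> by (simp add: rate_def w_def[symmetric])
  have "w * \<gamma> \<le> 1 * R"
    using w \<gamma> \<gamma>_le_R by (intro mult_mono) auto
  then show "0 \<le> rate k \<theta>"
    using R by (simp add: rate_def w_def[symmetric])
qed

text \<open>The chord bound is affine in \<open>X i\<close>; summing over i therefore leaves only
  the sum of the quadratic forms, where \<open>mean_ge\<close> applies.\<close>

lemma sum_approx_exp_le:
  assumes \<theta>: "0 < \<theta>" "\<theta> * R \<le> 2 ^ k"
  shows "(\<Sum>i\<in>{1..n}. u \<bullet> (approx_exp k (- (\<theta> *\<^sub>R X i)) *v u)) \<le> real n * rate k \<theta> * (u \<bullet> u)"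
proof -
  define r where "r = \<theta> * R / 2 ^ k"
  define w where "w = 1 - (1 - r) ^ (2 ^ k)"
  have r: "0 < r" "r \<le> 1"
    using \<theta> R by (simp_all add: r_def)
  have "0 \<le> w"
    unfolding w_def using r by (simp add: power_le_one)
  have "u \<bullet> (approx_exp k (- (\<theta> *\<^sub>R X i)) *v u) \<le> u \<bullet> u - w / R * (u \<bullet> (X i *v u))"
    if i: "i \<in> {1..n}" for i
  proof -
    define Z where "Z = (\<theta> / 2 ^ k) *\<^sub>R X i"
    have Zv: "v \<bullet> (Z *v v) = \<theta> / 2 ^ k * (v \<bullet> (X i *v v))" for v
      by (simp add: Z_def scaleR_matrix_vector)
    have "u \<bullet> (matpow (mat 1 - Z) (2 ^ k) *v u) \<le> u \<bullet> u - w / r * (u \<bullet> (Z *v u))"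
      unfolding w_def
    proof (rule matpow_le_chord)
      show "transpose Z = Z"
        by (simp add: Z_def transpose_scalar sym[OF i])
      show "0 \<le> v \<bullet> (Z *v v)" for v
        using pos[OF i, of v] \<theta> by (simp add: Zv)
      show "v \<bullet> (Z *v v) \<le> r * (v \<bullet> v)" for v
        using mult_left_mono[OF le[OF i, of v], of "\<theta> / 2 ^ k"] \<theta> by (simp add: Zv r_def mult_ac)
    qed (use r in auto)
    also have "matpow (mat 1 - Z) (2 ^ k) = approx_exp k (- (\<theta> *\<^sub>R X i))"
      by (simp add: approx_exp_def Z_def)
    also have "w / r * (u \<bullet> (Z *v u)) = w / R * (u \<bullet> (X i *v u))"
      using \<theta> R by (simp add: Zv r_def)
    finally show ?thesis .
  qed
  then have "(\<Sum>i\<in>{1..n}. u \<bullet> (approx_exp k (- (\<theta> *\<^sub>R X i)) *v u)) \<le>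
      (\<Sum>i\<in>{1..n}. u \<bullet> u - w / R * (u \<bullet> (X i *v u)))"
    by (intro sum_mono)
  also have "\<dots> = real n * (u \<bullet> u) - w / R * (\<Sum>i\<in>{1..n}. u \<bullet> (X i *v u))"
    by (simp add: sum_subtractf sum_distrib_left)
  also have "\<dots> \<le> real n * (u \<bullet> u) - w / R * (real n * \<gamma> * (u \<bullet> u))"
    using \<open>0 \<le> w\<close> R by (intro diff_left_mono mult_left_mono mean_ge) auto
  also have "\<dots> = real n * rate k \<theta> * (u \<bullet> u)"
    by (simp add: rate_def w_def r_def algebra_simps)
  finally show ?thesis .
qed

text \<open>For symmetric \<open>A\<close> this is the square of a symmetric matrix, which makes the
  potential nonnegative and gives the outer factors for \<open>trace_sandwich\<close>.\<close>

lemma approx_exp_square: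
  assumes "0 < k"
  shows "approx_exp k A = matpow (mat 1 + (1 / 2 ^ k) *\<^sub>R A) (2 ^ (k - 1)) **
    matpow (mat 1 + (1 / 2 ^ k) *\<^sub>R A) (2 ^ (k - 1))"
proof -
  have "(2::nat) ^ k = 2 * 2 ^ (k - 1)"
    using assms by (cases k) auto
  then show ?thesis
    unfolding approx_exp_def by (simp only: matpow_double)
qed

lemma potential_nonneg:
  assumes "0 < k" "transpose S = S"
  shows "0 \<le> potential k \<theta> S"
proof -
  define T where "T = matpow (mat 1 + (1 / 2 ^ k) *\<^sub>R (- (\<theta> *\<^sub>R S))) (2 ^ (k - 1))"
  have "transpose T = T"
    by (simp add: T_def transpose_matpow transpose_diff transpose_scalar assms)
  then have "potential k \<theta> S = T \<bullet> T"
    by (simp add: potential_def approx_exp_square[OF \<open>0 < k\<close>] inner_matrix_eq_trace T_def)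
  then show ?thesis
    by simp
qed

text \<open>Golden--Thompson with error detaches the new \<open>X i\<close> from \<open>S\<close>;
  after sandwiching, the sum over i acts on quadratic forms at the fixed vectors T e_j, which
  \<open>sum_approx_exp_le\<close> bounds.\<close>

lemma sum_potential_step:
  assumes \<theta>: "0 < \<theta>" "\<theta> * R \<le> 2 ^ k" and "0 < k"
    and symS: "transpose S = S" and S: "\<And>v. norm (S *v v) \<le> s * norm v" and "0 \<le> s"
  shows "(\<Sum>i\<in>{1..n}. potential k \<theta> (X i + S)) \<le> real n *
    (rate k \<theta> * potential k \<theta> S +
     real CARD('p) * (exp (\<theta> * s + \<theta> * R) * (\<theta> * s) * (\<theta> * R)) / 2 ^ k)"
proof -
  define err where "err = real CARD('p) * (exp (\<theta> * s + \<theta> * R) * (\<theta> * s) * (\<theta> * R)) / 2 ^ k"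
  define E where "E i = approx_exp k (- (\<theta> *\<^sub>R X i))" for i
  define T where "T = matpow (mat 1 + (1 / 2 ^ k) *\<^sub>R (- (\<theta> *\<^sub>R S))) (2 ^ (k - 1))"
  have symT: "transpose T = T"
    by (simp add: T_def transpose_matpow transpose_diff transpose_scalar symS)
  have ES: "approx_exp k (- (\<theta> *\<^sub>R S)) = T ** T"
    by (simp add: approx_exp_square[OF \<open>0 < k\<close>] T_def)
  have "potential k \<theta> (X i + S) \<le> trace (T ** T ** E i) + err" if i: "i \<in> {1..n}" for i
  proof -
    have *: "- (\<theta> *\<^sub>R (X i + S)) = - (\<theta> *\<^sub>R S) + - (\<theta> *\<^sub>R X i)"
      by (simp add: scaleR_right_distrib)
    show ?thesis
      unfolding potential_def * ES[symmetric] E_def err_def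
    proof (rule trace_approx_exp_add_le)
      show "norm (- (\<theta> *\<^sub>R S) *v v) \<le> \<theta> * s * norm v" for v
        using S[of v] \<theta> by (simp add: uminus_matrix_vector scaleR_matrix_vector)
      show "norm (- (\<theta> *\<^sub>R X i) *v v) \<le> \<theta> * R * norm v" for v
        using psd_norm_le[OF sym[OF i] pos[OF i] le[OF i] R, of v] \<theta>
        by (simp add: uminus_matrix_vector scaleR_matrix_vector)
    qed (use \<theta> R \<open>0 \<le> s\<close> in \<open>simp_all add: transpose_uminus transpose_scalar symS sym[OF i]\<close>)
  qed
  then have "(\<Sum>i\<in>{1..n}. potential k \<theta> (X i + S)) \<le> (\<Sum>i\<in>{1..n}. trace (T ** T ** E i) + err)"
    by (intro sum_mono)
  also have "\<dots> = (\<Sum>j\<in>UNIV. \<Sum>i\<in>{1..n}. (T *v axis j 1) \<bullet> (E i *v (T *v axis j 1))) + real n * err"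
    by (subst sum.swap) (simp add: sum.distrib trace_sandwich[OF symT])
  also have "\<dots> \<le> (\<Sum>j\<in>UNIV. real n * rate k \<theta> * ((T *v axis j 1) \<bullet> (T *v axis j 1))) + real n * err"
    unfolding E_def by (intro add_right_mono sum_mono sum_approx_exp_le \<theta>)
  also have "(\<Sum>j\<in>UNIV. real n * rate k \<theta> * ((T *v axis j 1) \<bullet> (T *v axis j 1))) =
      real n * rate k \<theta> * potential k \<theta> S"
    using trace_sandwich[OF symT, of "mat 1"]
    by (simp add: potential_def ES sum_distrib_left)
  finally show ?thesis
    by (simp add: err_def algebra_simps)
qed

lemma sum_list_family:
  assumes "set L \<subseteq> {1..n}"
  shows "transpose (\<Sum>j\<leftarrow>L. X j) = (\<Sum>j\<leftarrow>L. X j)"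
    and "norm ((\<Sum>j\<leftarrow>L. X j) *v v) \<le> real (length L) * R * norm v"
proof -
  show "transpose (\<Sum>j\<leftarrow>L. X j) = (\<Sum>j\<leftarrow>L. X j)"
    using assms by (intro transpose_sum_list sym) auto
  show "norm ((\<Sum>j\<leftarrow>L. X j) *v v) \<le> real (length L) * R * norm v"
    using assms
  proof (induction L)
    case (Cons i L)
    have i: "i \<in> {1..n}" and L: "set L \<subseteq> {1..n}"
      using Cons by auto
    have "norm (X i *v v + (\<Sum>j\<leftarrow>L. X j) *v v) \<le> R * norm v + real (length L) * R * norm v"
      by (intro norm_triangle_mono psd_norm_le[OF sym[OF i] pos[OF i] le[OF i] R] Cons.IH L)
    then show ?case
      by (simp add: matrix_vector_mult_add_rdistrib algebra_simps)
  qed simp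
qed

text \<open>The error of one draw with m R as norm bound for the partial sum, so that the same value
  serves all draws up to the m-th.\<close>

definition step_error :: "nat \<Rightarrow> real \<Rightarrow> nat \<Rightarrow> real" where
  "step_error k \<theta> m = real CARD('p) *
    (exp (\<theta> * (real m * R) + \<theta> * R) * (\<theta> * (real m * R)) * (\<theta> * R)) / 2 ^ k"

text \<open>Each draw multiplies the mean potential by at most \<open>rate\<close> and adds
  \<open>step_error\<close>. As \<open>rate\<close> is at most 1, earlier errors do not grow and
  simply add up.\<close>

lemma sum_potential_with_le:
  assumes \<theta>: "0 < \<theta>" "\<theta> * R \<le> 2 ^ k" and "0 < k" and "l \<le> m"
  shows "(\<Sum>L\<in>samples With_Replacement n l. potential k \<theta> (\<Sum>j\<leftarrow>L. X j)) \<le>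
    real n ^ l * (real CARD('p) * rate k \<theta> ^ l + real l * step_error k \<theta> m)"
  using \<open>l \<le> m\<close>
proof (induction l)
  case 0
  then show ?case
    by (simp add: samples_0 potential_def approx_exp_def trace_I del: samples.simps)
next
  case (Suc l)
  let ?W = "samples With_Replacement n"
  let ?S = "\<lambda>L. \<Sum>j\<leftarrow>L. X j"
  have err: "0 \<le> step_error k \<theta> m"
    using \<theta> R by (simp add: step_error_def)
  have "(\<Sum>L\<in>?W (Suc l). potential k \<theta> (?S L)) = (\<Sum>L\<in>?W l. \<Sum>i\<in>{1..n}. potential k \<theta> (X i + ?S L))"
    by (simp add: sum_samples_with_Suc del: samples.simps)
  also have "\<dots> \<le> (\<Sum>L\<in>?W l. real n * (rate k \<theta> * potential k \<theta> (?S L) + step_error k \<theta> m))"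
    unfolding step_error_def
  proof (intro sum_mono sum_potential_step \<theta> \<open>0 < k\<close>)
    fix L assume L: "L \<in> ?W l"
    note L' = set_samples_subset[OF L] length_samples[OF L]
    show "transpose (?S L) = ?S L"
      by (rule sum_list_family[OF L'(1)])
    show "norm (?S L *v v) \<le> real m * R * norm v" for v
    proof (rule order_trans[OF sum_list_family(2)[OF L'(1)]])
      show "real (length L) * R * norm v \<le> real m * R * norm v"
        using Suc.prems L'(2) R by (intro mult_right_mono) auto
    qed
  qed (use R in simp)
  also have "\<dots> = real n * rate k \<theta> * (\<Sum>L\<in>?W l. potential k \<theta> (?S L)) + real n * real n ^ l * step_error k \<theta> m"
    by (simp add: sum.distrib sum_distrib_left card_samples_with algebra_simps del: samples.simps)
  also have "\<dots> \<le> real n * rate k \<theta> *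
      (real n ^ l * (real CARD('p) * rate k \<theta> ^ l + real l * step_error k \<theta> m)) +
      real n * real n ^ l * step_error k \<theta> m"
    using rate_bounds[OF \<theta>] Suc by (intro add_right_mono mult_left_mono) auto
  also have "\<dots> = real n ^ Suc l *
      (real CARD('p) * rate k \<theta> ^ Suc l + rate k \<theta> * (real l * step_error k \<theta> m) + step_error k \<theta> m)"
    by (simp add: algebra_simps)
  also have "\<dots> \<le> real n ^ Suc l *
      (real CARD('p) * rate k \<theta> ^ Suc l + real l * step_error k \<theta> m + step_error k \<theta> m)"
    using rate_bounds[OF \<theta>] err by (intro mult_left_mono add_mono mult_left_le_one_le order_refl) auto
  finally show ?case
    by (simp add: algebra_simps)
qed

lemma sum_potential_le:
  assumes \<theta>: "0 < \<theta>" "\<theta> * R \<le> 2 ^ k" and "0 < k" and "md = Without_Replacement \<Longrightarrow> m \<le> n"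
  shows "(\<Sum>L\<in>samples md n m. potential k \<theta> (\<Sum>j\<leftarrow>L. X j)) \<le>
    real (card (samples md n m)) * (real CARD('p) * rate k \<theta> ^ m + real m * step_error k \<theta> m)"
proof (cases md)
  case With_Replacement
  then show ?thesis
    using sum_potential_with_le[OF assms(1-3) order_refl] by (simp add: card_samples_with del: samples.simps)
next
  case Without_Replacement
  \<comment> \<open>Midpoint convexity of the potential is known between symmetric matrices, which
    form the subspace for the comparison of the schemes.\<close>
  define V where "V = {A :: real ^ 'p ^ 'p. transpose A = A}"
  have "subspace V"
    by (rule subspaceI) (auto simp: V_def transpose_add transpose_scalar transpose_zero)
  have "real n ^ m * (\<Sum>L\<in>samples Without_Replacement n m. potential k \<theta> (\<Sum>j\<leftarrow>L. X j)) \<le>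
      real (card (samples Without_Replacement n m)) *
        (\<Sum>L\<in>samples With_Replacement n m. potential k \<theta> (\<Sum>j\<leftarrow>L. X j))"
  proof (rule sum_samples_without_le_with[OF \<open>subspace V\<close>])
    fix A B assume "A \<in> V" "B \<in> V"
    then have sAB: "transpose A = A" "transpose B = B"
      by (auto simp: V_def)
    have *: "mat 1 + (1 / 2 ^ k) *\<^sub>R (- (\<theta> *\<^sub>R ((1/2) *\<^sub>R (A + B)))) =
        (1/2) *\<^sub>R ((mat 1 + (1 / 2 ^ k) *\<^sub>R (- (\<theta> *\<^sub>R A))) + (mat 1 + (1 / 2 ^ k) *\<^sub>R (- (\<theta> *\<^sub>R B))))"
      by (simp add: vec_eq_iff field_simps)
    show "potential k \<theta> ((1/2) *\<^sub>R (A + B)) \<le> (potential k \<theta> A + potential k \<theta> B) / 2"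
      unfolding potential_def approx_exp_def *
      by (rule trace_matpow_midpoint_convex) (simp_all add: transpose_diff transpose_scalar sAB)
  qed (use assms Without_Replacement sym in \<open>auto simp: V_def\<close>)
  also have "\<dots> \<le> real (card (samples Without_Replacement n m)) *
      (real n ^ m * (real CARD('p) * rate k \<theta> ^ m + real m * step_error k \<theta> m))"
    by (intro mult_left_mono sum_potential_with_le assms) auto
  finally have "real n ^ m * (\<Sum>L\<in>samples Without_Replacement n m. potential k \<theta> (\<Sum>j\<leftarrow>L. X j)) \<le>
      real n ^ m * (real (card (samples Without_Replacement n m)) *
        (real CARD('p) * rate k \<theta> ^ m + real m * step_error k \<theta> m))"
    by (simp only: mult.left_commute)
  then show ?thesis
    using n Without_Replacement by (simp del: samples.simps)
qed

text \<open>Markov's inequality by counting: every bad sample has potential at least (1 - \<theta> t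
  / N)^N, while the total potential is bounded by \<open>sum_potential_le\<close>. As k grows, the
  errors vanish and the powers become exponentials.\<close>

lemma card_bad_samples_le:
  assumes \<theta>: "0 < \<theta>" and mn: "md = Without_Replacement \<Longrightarrow> m \<le> n"
  shows "real (card {L \<in> samples md n m. \<exists>v. v \<bullet> ((\<Sum>j\<leftarrow>L. X j) *v v) < t * (v \<bullet> v)}) \<le>
    real (card (samples md n m)) *
      (real CARD('p) * (exp (\<theta> * t) * (1 - (1 - exp (- (\<theta> * R))) * \<gamma> / R) ^ m))"
    (is "real (card ?bad) \<le> _")
proof -
  have pow: "(\<lambda>k. (1 + x / 2 ^ k) ^ (2 ^ k)) \<longlonglongrightarrow> exp x" for x :: real
    using LIMSEQ_subseq_LIMSEQ[OF tendsto_exp_limit_sequentially, of "\<lambda>k. 2 ^ k" x]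
    by (simp add: o_def strict_mono_def)
  have inv0: "(\<lambda>k. c / 2 ^ k) \<longlonglongrightarrow> 0" for c :: real
    using tendsto_mult[OF tendsto_const[of c] LIMSEQ_realpow_zero[of "1/2"]]
    by (simp add: power_divide)
  have rate: "(\<lambda>k. rate k \<theta>) \<longlonglongrightarrow> 1 - (1 - exp (- (\<theta> * R))) * \<gamma> / R"
    unfolding rate_def using pow[of "- (\<theta> * R)"] R by (auto intro!: tendsto_intros)
  have err: "(\<lambda>k. step_error k \<theta> m) \<longlonglongrightarrow> 0"
    unfolding step_error_def by (rule inv0)
  have lim1: "(\<lambda>k. real (card ?bad) * (1 + - (\<theta> * t) / 2 ^ k) ^ (2 ^ k)) \<longlonglongrightarrow>
      real (card ?bad) * exp (- (\<theta> * t))"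
    by (intro tendsto_intros pow)
  have lim2: "(\<lambda>k. real (card (samples md n m)) * (real CARD('p) * rate k \<theta> ^ m + real m * step_error k \<theta> m))
     \<longlonglongrightarrow> real (card (samples md n m)) *
      (real CARD('p) * (1 - (1 - exp (- (\<theta> * R))) * \<gamma> / R) ^ m + real m * 0)"
    by (intro tendsto_intros rate err)
  \<comment> \<open>For such k the exponent is even, the chord interval lies in [0, 1], and the base
    c below is nonnegative, as \<open>trace_matpow_ge\<close> demands.\<close>
  have ev: "\<forall>\<^sub>F k in sequentially. 0 < k \<and> \<theta> * R / 2 ^ k < 1 \<and> \<theta> * t / 2 ^ k < 1"
    by (intro eventually_conj eventually_gt_at_top order_tendstoD(2)[OF inv0]) auto
  have "\<forall>\<^sub>F k in sequentially. real (card ?bad) * (1 + - (\<theta> * t) / 2 ^ k) ^ (2 ^ k) \<le>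
      real (card (samples md n m)) * (real CARD('p) * rate k \<theta> ^ m + real m * step_error k \<theta> m)"
    using ev
  proof eventually_elim
    case (elim k)
    define c where "c = 1 + - (\<theta> * t) / 2 ^ k"
    have k: "0 < k" and c: "0 \<le> c" and \<theta>R: "\<theta> * R \<le> 2 ^ k"
      using elim by (auto simp: c_def)
    have low: "c ^ (2 ^ k) \<le> potential k \<theta> (\<Sum>j\<leftarrow>L. X j)" if bad: "L \<in> ?bad" for L
    proof -
      define S where "S = (\<Sum>j\<leftarrow>L. X j)"
      have symS: "transpose S = S"
        unfolding S_def using bad by (intro sum_list_family set_samples_subset) auto
      obtain v where v: "v \<bullet> (S *v v) < t * (v \<bullet> v)"
        using bad by (auto simp: S_def)
      define u where "u = (1 / norm v) *\<^sub>R v"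
      have "v \<noteq> 0"
        using v by auto
      then have u: "norm u = 1"
        by (simp add: u_def)
      have "u \<bullet> (S *v u) = (v \<bullet> (S *v v)) / (v \<bullet> v)"
        using \<open>v \<noteq> 0\<close>
        by (simp add: u_def matrix_vector_mult_scaleR dot_square_norm power2_eq_square)
      also have "\<dots> \<le> t"
        using v \<open>v \<noteq> 0\<close> by (simp add: divide_le_eq)
      finally have uS: "u \<bullet> (S *v u) \<le> t" .
      show ?thesis
        unfolding potential_def approx_exp_def S_def[symmetric]
      proof (rule trace_matpow_ge[OF _ u c _ k])
        show "transpose (mat 1 + (1 / 2 ^ k) *\<^sub>R - (\<theta> *\<^sub>R S)) = mat 1 + (1 / 2 ^ k) *\<^sub>R - (\<theta> *\<^sub>R S)"
          by (simp add: transpose_diff transpose_scalar symS)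
        have "u \<bullet> ((mat 1 + (1 / 2 ^ k) *\<^sub>R - (\<theta> *\<^sub>R S)) *v u) = 1 - \<theta> * (u \<bullet> (S *v u)) / 2 ^ k"
          using u by (simp add: matrix_vector_mult_diff_rdistrib scaleR_matrix_vector inner_diff_right norm_eq_1)
        then show "c \<le> u \<bullet> ((mat 1 + (1 / 2 ^ k) *\<^sub>R - (\<theta> *\<^sub>R S)) *v u)"
          using uS \<theta> by (simp add: c_def divide_right_mono)
      qed
    qed
    have "real (card ?bad) * c ^ (2 ^ k) = (\<Sum>L\<in>?bad. c ^ (2 ^ k))"
      by simp
    also have "\<dots> \<le> (\<Sum>L\<in>?bad. potential k \<theta> (\<Sum>j\<leftarrow>L. X j))"
      by (intro sum_mono low)
    also have "\<dots> \<le> (\<Sum>L\<in>samples md n m. potential k \<theta> (\<Sum>j\<leftarrow>L. X j))"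
      by (intro sum_mono2) (auto intro!: potential_nonneg k sum_list_family dest: set_samples_subset)
    also have "\<dots> \<le> real (card (samples md n m)) * (real CARD('p) * rate k \<theta> ^ m + real m * step_error k \<theta> m)"
      by (rule sum_potential_le[OF \<theta> \<theta>R k mn])
    finally show ?case
      by (simp add: c_def)
  qed
  from tendsto_le[OF _ lim2 lim1 this]
  have "real (card ?bad) * exp (- (\<theta> * t)) \<le> real (card (samples md n m)) *
      (real CARD('p) * (1 - (1 - exp (- (\<theta> * R))) * \<gamma> / R) ^ m)"
    by simp
  from mult_right_mono[OF this, of "exp (\<theta> * t)"]
  have "real (card ?bad) * (exp (- (\<theta> * t)) * exp (\<theta> * t)) \<le> real (card (samples md n m)) *
      (real CARD('p) * (exp (\<theta> * t) * (1 - (1 - exp (- (\<theta> * R))) * \<gamma> / R) ^ m))"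
    by (simp only: mult_ac) simp
  moreover have "exp (- (\<theta> * t)) * exp (\<theta> * t) = 1"
    by (simp flip: exp_add)
  ultimately show ?thesis
    by simp
qed

end

section \<open>Probability of a well-conditioned sample\<close>

text \<open>The difference of the two sides vanishes at 0 and has derivative - ln (1 - x) - x, which
  is nonnegative. It reduces the optimized Chernoff exponent to - \<epsilon>^2 / 2.\<close>

lemma one_minus_ln_ge:
  fixes \<epsilon> :: real
  assumes "0 \<le> \<epsilon>" "\<epsilon> < 1"
  shows "\<epsilon>\<^sup>2 / 2 - \<epsilon> \<le> (1 - \<epsilon>) * ln (1 - \<epsilon>)"
proof -
  define f where "f x = (1 - x) * ln (1 - x) + x - x\<^sup>2 / 2" for x :: real
  have "f 0 \<le> f \<epsilon>"
  proof (rule DERIV_nonneg_imp_nondecreasing[OF assms(1)])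
    fix x assume x: "0 \<le> x" "x \<le> \<epsilon>"
    then have "x < 1"
      using assms by simp
    have "((\<lambda>x. (1 - x) * ln (1 - x)) has_real_derivative
        (0 - 1) * ln (1 - x) + 1 / (1 - x) * (0 - 1) * (1 - x)) (at x)"
      using \<open>x < 1\<close> by (intro derivative_intros DERIV_chain') auto
    then have "((\<lambda>x. (1 - x) * ln (1 - x)) has_real_derivative - ln (1 - x) - 1) (at x)"
      using \<open>x < 1\<close> by simp
    moreover have "((\<lambda>x. x\<^sup>2 / 2) has_real_derivative x) (at x)"
      by (auto intro!: derivative_eq_intros)
    ultimately have "(f has_real_derivative - ln (1 - x) - 1 + 1 - x) (at x)"
      unfolding f_def by (intro derivative_intros)
    then have "(f has_real_derivative - ln (1 - x) - x) (at x)"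
      by simp
    moreover have "0 \<le> - ln (1 - x) - x"
      using ln_le_minus_one[of "1 - x"] \<open>x < 1\<close> by simp
    ultimately show "\<exists>y. DERIV f x :> y \<and> 0 \<le> y"
      by blast
  qed
  then show ?thesis
    by (simp add: f_def)
qed

lemma (in bounded_psd_family) prob_sum_ge:
  assumes mn: "md = Without_Replacement \<Longrightarrow> m \<le> n" and \<delta>: "0 < \<delta>" and \<epsilon>: "0 < \<epsilon>" "\<epsilon> < 1"
    and m: "real m \<ge> 2 * (R / \<gamma>) * ln (real CARD('p) / \<delta>) / \<epsilon>\<^sup>2"
  shows "measure_pmf.prob (sample_pmf md n m)
    {L. L \<in> samples md n m \<and> (\<forall>v. (1 - \<epsilon>) * \<gamma> * real m * (v \<bullet> v) \<le> v \<bullet> ((\<Sum>j\<leftarrow>L. X j) *v v))} \<ge> 1 - \<delta>"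
proof -
  \<comment> \<open>The minimizer of \<theta> t - (1 - exp (- \<theta> R)) m \<gamma> / R, the
    exponent after 1 - x \<le> exp (- x); there exp (- \<theta> R) = 1 - \<epsilon>.\<close>
  define \<theta> where "\<theta> = - ln (1 - \<epsilon>) / R"
  define t where "t = (1 - \<epsilon>) * \<gamma> * real m"
  define good where "good = {L. L \<in> samples md n m \<and> (\<forall>v. t * (v \<bullet> v) \<le> v \<bullet> ((\<Sum>j\<leftarrow>L. X j) *v v))}"
  define bad where "bad = {L \<in> samples md n m. \<exists>v. v \<bullet> ((\<Sum>j\<leftarrow>L. X j) *v v) < t * (v \<bullet> v)}"
  define c where "c = card (samples md n m)"
  have c: "0 < c"
    unfolding c_def using n mn by (rule card_samples_pos)
  have \<theta>: "0 < \<theta>"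
    using \<epsilon> R by (simp add: \<theta>_def divide_neg_pos)
  have eR: "exp (- (\<theta> * R)) = 1 - \<epsilon>"
    using \<epsilon> R by (simp add: \<theta>_def)
  define u where "u = real m * \<gamma> / R"
  have u: "0 \<le> u"
    using R \<gamma> by (simp add: u_def)
  \<comment> \<open>Keeps the base 1 - \<epsilon> \<gamma> / R nonnegative, so that the bound on it
    may be raised to the power m.\<close>
  have "\<epsilon> * \<gamma> / R \<le> 1"
    using mult_mono[of \<epsilon> 1 \<gamma> R] \<epsilon> \<gamma> \<gamma>_le_R R by simp
  then have "(1 - \<epsilon> * \<gamma> / R) ^ m \<le> exp (- (\<epsilon> * \<gamma> / R)) ^ m"
    using exp_ge_add_one_self[of "- (\<epsilon> * \<gamma> / R)"] by (intro power_mono) auto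
  also have "\<dots> = exp (- (\<epsilon> * u))"
    by (simp add: exp_of_nat_mult[symmetric] u_def mult_ac)
  finally have "exp (\<theta> * t) * (1 - (1 - exp (- (\<theta> * R))) * \<gamma> / R) ^ m \<le> exp (\<theta> * t) * exp (- (\<epsilon> * u))"
    by (intro mult_left_mono) (simp_all add: eR)
  also have "\<dots> = exp (u * (- ((1 - \<epsilon>) * ln (1 - \<epsilon>)) - \<epsilon>))"
    by (simp add: exp_add[symmetric] \<theta>_def t_def u_def algebra_simps add_divide_distrib)
  also have "\<dots> \<le> exp (u * (- (\<epsilon>\<^sup>2 / 2)))"
    unfolding exp_le_cancel_iff using one_minus_ln_ge[of \<epsilon>] \<epsilon> u by (intro mult_left_mono) auto
  also have "\<dots> \<le> exp (- ln (real CARD('p) / \<delta>))"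
  proof -
    have "2 * (R / \<gamma>) * ln (real CARD('p) / \<delta>) \<le> real m * \<epsilon>\<^sup>2"
      using m zero_less_power[OF \<epsilon>(1), of 2] by (simp only: pos_divide_le_eq)
    from mult_right_mono[OF this, of "\<gamma> / R"] have "2 * ln (real CARD('p) / \<delta>) \<le> u * \<epsilon>\<^sup>2"
      using R \<gamma> by (simp add: u_def field_simps)
    then show ?thesis
      by simp
  qed
  also have "\<dots> = \<delta> / real CARD('p)"
    using \<delta> by (simp add: exp_minus)
  finally have tail: "exp (\<theta> * t) * (1 - (1 - exp (- (\<theta> * R))) * \<gamma> / R) ^ m \<le> \<delta> / real CARD('p)" .
  have "real (card bad) \<le> real c *
      (real CARD('p) * (exp (\<theta> * t) * (1 - (1 - exp (- (\<theta> * R))) * \<gamma> / R) ^ m))"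
    unfolding bad_def c_def by (rule card_bad_samples_le[OF \<theta> mn])
  also have "\<dots> \<le> real c * (real CARD('p) * (\<delta> / real CARD('p)))"
    by (intro mult_left_mono tail) auto
  finally have bad: "real (card bad) \<le> \<delta> * real c"
    by (simp add: mult.commute)
  have "good = samples md n m - bad"
    by (auto simp: good_def bad_def simp flip: not_less)
  moreover have "bad \<subseteq> samples md n m"
    by (auto simp: bad_def)
  ultimately have "real (card good) = real c - real (card bad)"
    using finite_subset[of bad "samples md n m"]
    by (simp add: card_Diff_subset c_def of_nat_diff card_mono)
  moreover have "measure_pmf.prob (sample_pmf md n m) good = real (card good) / real c"
  proof -
    have "samples md n m \<inter> good = good"
      by (auto simp: good_def)
    moreover have "samples md n m \<noteq> {}"
      using c by (auto simp: c_def)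
    ultimately show ?thesis
      by (simp add: sample_pmf_def measure_pmf_of_set c_def)
  qed
  ultimately have "1 - \<delta> \<le> measure_pmf.prob (sample_pmf md n m) good"
    using bad c by (simp only:) (simp add: pos_le_divide_eq left_diff_distrib)
  then show ?thesis
    by (simp only: good_def t_def)
qed

text \<open>Greedy matching along \<open>ys\<close>: the head y is paired with some z in
  \<open>Z\<close>, z \<le> y, such that the rest of \<open>Z\<close> fits into the tail. If y
  occurs in \<open>Z\<close>, z is y itself; otherwise \<open>Z\<close> lies in the tail already and
  any element will do.\<close>

lemma sum_mset_le_sum_list_take:
  fixes ys :: "real list"
  assumes "sorted_wrt (\<ge>) ys" "Z \<subseteq># mset ys"
  shows "sum_mset Z \<le> sum_list (take (size Z) ys)"
  using assms
proof (induction ys arbitrary: Z)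
  case (Cons y ys)
  show ?case
  proof (cases "Z = {#}")
    case False
    obtain z where z: "z \<in># Z" "z \<le> y" "Z - {#z#} \<subseteq># mset ys"
    proof (cases "y \<in># Z")
      case True
      then show ?thesis
        using that[of y] Cons.prems by (simp add: subset_eq_diff_conv)
    next
      case y: False
      obtain z where zZ: "z \<in># Z"
        using False by auto
      have "Z - {#y#} \<subseteq># mset ys"
        using Cons.prems(2) by (simp add: subset_eq_diff_conv)
      then have "Z \<subseteq># mset ys"
        using y by (simp add: diff_single_trivial)
      moreover from this zZ have "z \<in> set ys"
        by (metis mset_subset_eqD set_mset_mset)
      ultimately show ?thesis
        using that[of z] zZ Cons.prems(1) by (auto intro: subset_mset.order_trans[OF diff_subset_eq_self])
    qed
    have "sum_mset Z = z + sum_mset (Z - {#z#})"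
      using z(1) by (metis insert_DiffM sum_mset.add_mset)
    also have "\<dots> \<le> y + sum_list (take (size (Z - {#z#})) ys)"
      using z Cons by (intro add_mono Cons.IH) auto
    also have "\<dots> = sum_list (take (size Z) (y # ys))"
      using size_Suc_Diff1[OF z(1)] by (cases "size Z") auto
    finally show ?thesis .
  qed simp
qed simp

text \<open>Distinct indices give a sub-multiset of 1, ..., n, and mapping \<open>Ks\<close> over
  multisets preserves multiplicities, so ties among the values are counted correctly.\<close>

lemma sum_list_le_top_avg:
  assumes "distinct L" "set L \<subseteq> {1..n}"
  shows "(\<Sum>j\<leftarrow>L. Ks j) \<le> real (length L) * top_avg n Ks (length L)"
proof (cases "L = []")
  case False
  let ?xs = "map Ks [1..<n + 1]"
  have "mset L \<subseteq># mset [1..<n + 1]"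
  proof -
    have "mset L = mset_set (set L)"
      using assms(1) by (simp add: mset_set_set)
    moreover have "mset [1..<n + 1] = mset_set {1..<n + 1}"
      by (rule mset_upt)
    moreover have "set L \<subseteq> {1..<n + 1}"
      using assms(2) by auto
    ultimately show ?thesis
      by (metis finite_atLeastLessThan subset_imp_msubset_mset_set)
  qed
  then have "mset (map Ks L) \<subseteq># mset ?xs"
    unfolding mset_map by (rule image_mset_subseteq_mono)
  then have "mset (map Ks L) \<subseteq># mset (rev (sort ?xs))"
    by simp
  moreover have "sorted_wrt (\<ge>) (rev (sort ?xs))"
    by (simp add: sorted_wrt_rev)
  ultimately have "sum_mset (mset (map Ks L)) \<le> sum_list (take (size (mset (map Ks L))) (rev (sort ?xs)))"
    by (intro sum_mset_le_sum_list_take)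
  then show ?thesis
    using False unfolding top_avg_def sum_mset_sum_list by simp
qed simp

lemma le_top_avg_1: "i \<in> {1..n} \<Longrightarrow> Ks i \<le> top_avg n Ks 1"
  using sum_list_le_top_avg[of "[i]" n Ks] by simp

section \<open>Gradients, Hessians and the Newton step\<close>

text \<open>\<open>gradient\<close> is a definite description, so the representing vector must
  exist, built here from the values of the derivative on the basis, and be unique.\<close>

lemma GDERIV_gradient:
  fixes f :: "real ^ 'p \<Rightarrow> real"
  assumes "f differentiable (at x)"
  shows "GDERIV f x :> gradient f x"
proof -
  obtain D where D: "(f has_derivative D) (at x)"
    using assms by (auto simp: differentiable_def)
  then have lin: "linear D"
    by (rule has_derivative_linear)
  define g where "g = (\<Sum>b\<in>Basis. D b *\<^sub>R b)"
  have "D = (\<lambda>h. h \<bullet> g)"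
  proof
    fix h
    have "D h = D (\<Sum>b\<in>Basis. (h \<bullet> b) *\<^sub>R b)"
      by (simp add: euclidean_representation)
    also have "\<dots> = (\<Sum>b\<in>Basis. (h \<bullet> b) * D b)"
      by (simp add: linear_sum[OF lin] linear_scale[OF lin])
    also have "\<dots> = h \<bullet> g"
      by (simp add: g_def inner_sum_right mult.commute)
    finally show "D h = h \<bullet> g" .
  qed
  then have "GDERIV f x :> g"
    using D by (simp add: gderiv_def)
  moreover have "g' = g" if "GDERIV f x :> g'" for g'
    using has_derivative_unique[OF that[unfolded gderiv_def] calculation[unfolded gderiv_def]]
    by (metis inner_commute vector_eq_ldot)
  ultimately show ?thesis
    unfolding gradient_def by (metis theI)
qed

lemma gradient_eqI:
  assumes "GDERIV f x :> (g :: real ^ 'p)"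
  shows "gradient f x = g"
proof -
  have "f differentiable (at x)"
    using assms unfolding gderiv_def by (rule differentiableI)
  from has_derivative_unique[OF GDERIV_gradient[OF this, unfolded gderiv_def] assms[unfolded gderiv_def]]
  show ?thesis
    by (metis vector_eq_ldot)
qed

lemma gradient_has_derivative:
  assumes "twice_differentiable f"
  shows "(gradient f has_derivative (\<lambda>h. hessian f x *v h)) (at x)"
  using assms jacobian_works[of "gradient f" "at x"] by (simp add: twice_differentiable_def hessian_def)

section \<open>Derivatives of the finite-sum objective\<close>

context
  fixes f :: "nat \<Rightarrow> real ^ 'p \<Rightarrow> real" and n :: nat
  assumes n: "1 \<le> n" and twice: "\<And>i. i \<in> {1..n} \<Longrightarrow> twice_differentiable (f i)"
begin

lemma GDERIV_objective:
  "GDERIV (objective n f) x :> (1 / real n) *\<^sub>R (\<Sum>i\<in>{1..n}. gradient (f i) x)"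
proof -
  have "(f i has_derivative (\<lambda>h. h \<bullet> gradient (f i) x)) (at x)" if "i \<in> {1..n}" for i
    using GDERIV_gradient[of "f i" x] twice[OF that] by (simp add: twice_differentiable_def gderiv_def)
  then have "((\<lambda>x. (1 / real n) * (\<Sum>i\<in>{1..n}. f i x)) has_derivative
      (\<lambda>h. (1 / real n) * (\<Sum>i\<in>{1..n}. h \<bullet> gradient (f i) x))) (at x)"
    by (intro has_derivative_mult_right has_derivative_sum)
  moreover have "(\<lambda>h. (1 / real n) * (\<Sum>i\<in>{1..n}. h \<bullet> gradient (f i) x)) =
      (\<lambda>h. h \<bullet> ((1 / real n) *\<^sub>R (\<Sum>i\<in>{1..n}. gradient (f i) x)))"
    by (simp add: inner_sum_right)
  moreover have "(\<lambda>x. (1 / real n) * (\<Sum>i\<in>{1..n}. f i x)) = objective n f"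
    by (simp add: objective_def fun_eq_iff)
  ultimately show ?thesis
    unfolding gderiv_def by simp
qed

lemma gradient_objective_has_derivative:
  "(gradient (objective n f) has_derivative
     (\<lambda>h. (1 / real n) *\<^sub>R (\<Sum>i\<in>{1..n}. hessian (f i) x *v h))) (at x)"
proof -
  have "gradient (objective n f) = (\<lambda>x. (1 / real n) *\<^sub>R (\<Sum>i\<in>{1..n}. gradient (f i) x))"
    using gradient_eqI[OF GDERIV_objective] by (simp add: fun_eq_iff)
  moreover have "((\<lambda>x. (1 / real n) *\<^sub>R (\<Sum>i\<in>{1..n}. gradient (f i) x)) has_derivative
     (\<lambda>h. (1 / real n) *\<^sub>R (\<Sum>i\<in>{1..n}. hessian (f i) x *v h))) (at x)"
    by (intro has_derivative_scaleR_right has_derivative_sum gradient_has_derivative twice)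
  ultimately show ?thesis
    by simp
qed

lemma twice_differentiable_objective: "twice_differentiable (objective n f)"
  using GDERIV_objective gradient_objective_has_derivative
  unfolding twice_differentiable_def gderiv_def differentiable_def by blast

lemma hessian_objective:
  "hessian (objective n f) x *v h = (1 / real n) *\<^sub>R (\<Sum>i\<in>{1..n}. hessian (f i) x *v h)"
  using has_derivative_unique[OF gradient_has_derivative[OF twice_differentiable_objective]
      gradient_objective_has_derivative] by (rule fun_cong)

end

text \<open>Maclaurin's theorem with Lagrange remainder for t \<mapsto> F (x + t d) on [0, 1]. This
  form of the remainder asks only that the second derivative exist, which is what
  \<open>twice_differentiable\<close> provides.\<close>

lemma second_order_expansion:
  fixes F :: "real ^ 'p \<Rightarrow> real"
  assumes F: "twice_differentiable F"
  shows "\<exists>z. F (x + d) = F x + d \<bullet> gradient F x + d \<bullet> (hessian F z *v d) / 2"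
proof -
  define D :: "nat \<Rightarrow> real \<Rightarrow> real" where
    "D i t = (if i = 0 then F (x + t *\<^sub>R d) else if i = 1 then d \<bullet> gradient F (x + t *\<^sub>R d)
       else d \<bullet> (hessian F (x + t *\<^sub>R d) *v d))" for i t
  have line: "((\<lambda>t. x + t *\<^sub>R d) has_derivative (\<lambda>s. s *\<^sub>R d)) (at t)" for t
    by (auto intro!: derivative_eq_intros)
  have D0: "DERIV (D 0) t :> D 1 t" for t
  proof -
    have "(F has_derivative (\<lambda>h. h \<bullet> gradient F (x + t *\<^sub>R d))) (at (x + t *\<^sub>R d))"
      using F GDERIV_gradient by (auto simp: twice_differentiable_def gderiv_def)
    from diff_chain_at[OF line this]
    have "((\<lambda>t. F (x + t *\<^sub>R d)) has_derivative (\<lambda>s. D 1 t * s)) (at t)"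
      by (simp add: D_def o_def mult.commute)
    moreover have "D 0 = (\<lambda>t. F (x + t *\<^sub>R d))"
      by (simp add: D_def fun_eq_iff)
    ultimately show ?thesis
      by (simp add: has_field_derivative_def)
  qed
  have D1: "DERIV (D 1) t :> D 2 t" for t
  proof -
    have "((\<lambda>t. gradient F (x + t *\<^sub>R d)) has_derivative (\<lambda>s. hessian F (x + t *\<^sub>R d) *v (s *\<^sub>R d))) (at t)"
      using diff_chain_at[OF line gradient_has_derivative[OF F]] by (simp add: o_def)
    then have "((\<lambda>t. d \<bullet> gradient F (x + t *\<^sub>R d)) has_derivative
        (\<lambda>s. d \<bullet> (hessian F (x + t *\<^sub>R d) *v (s *\<^sub>R d)))) (at t)"
      by (rule has_derivative_inner_right)
    then have "((\<lambda>t. d \<bullet> gradient F (x + t *\<^sub>R d)) has_derivative (\<lambda>s. D 2 t * s)) (at t)"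
      by (simp add: D_def matrix_vector_mult_scaleR mult.commute)
    moreover have "D 1 = (\<lambda>t. d \<bullet> gradient F (x + t *\<^sub>R d))"
      by (simp add: D_def fun_eq_iff)
    ultimately show ?thesis
      by (simp add: has_field_derivative_def)
  qed
  have "\<exists>t. 0 < t \<and> t < 1 \<and> D 0 1 = (\<Sum>m<2. D m 0 / fact m * 1 ^ m) + D 2 t / fact 2 * 1 ^ 2"
  proof (rule Maclaurin)
    have "DERIV (D m) t :> D (Suc m) t" if "m < 2" for m t
      using D0[of t] D1[of t] less_2_cases[OF that] by (auto simp: numeral_2_eq_2)
    then show "\<forall>m t. m < 2 \<and> 0 \<le> t \<and> t \<le> (1::real) \<longrightarrow> DERIV (D m) t :> D (Suc m) t"
      by blast
  qed auto
  then show ?thesis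
    by (auto simp: D_def numeral_2_eq_2)
qed

section \<open>The line search and the progress of one Newton step\<close>

lemma mat_vector_mult: "mat c *v v = c *\<^sub>R (v :: real ^ 'p)"
proof -
  have "mat c = c *\<^sub>R (mat 1 :: real ^ 'p ^ 'p)"
    by (simp add: mat_def vec_eq_iff)
  then show ?thesis
    by (simp add: scaleR_matrix_vector)
qed

lemma matrix_mult_matrix_inv: "invertible A \<Longrightarrow> A ** matrix_inv A = mat 1"
  unfolding invertible_def matrix_inv_def by (rule someI2_ex) auto

lemma loewner_leD:
  assumes "A \<preceq> B"
  shows "v \<bullet> (A *v v) \<le> v \<bullet> (B *v v)" and "transpose (B - A) = B - A"
proof -
  show "transpose (B - A) = B - A"
    using assms by (simp add: loewner_le_def symmetric_psd_def)
  have "0 \<le> v \<bullet> ((B - A) *v v)"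
    using assms by (simp add: loewner_le_def symmetric_psd_def)
  then show "v \<bullet> (A *v v) \<le> v \<bullet> (B *v v)"
    by (simp add: matrix_vector_mult_diff_rdistrib inner_diff_right)
qed

text \<open>The gap to any value of \<open>F\<close> is bounded by minimizing the quadratic lower model.\<close>

lemma gradient_dominance:
  fixes F :: "real ^ 'p \<Rightarrow> real"
  assumes F: "twice_differentiable F" and lo: "\<And>z v. \<gamma> * (v \<bullet> v) \<le> v \<bullet> (hessian F z *v v)"
    and "0 < \<gamma>"
  shows "2 * \<gamma> * (F x - F z) \<le> gradient F x \<bullet> gradient F x"
proof -
  define g d where "g = gradient F x" and "d = z - x"
  obtain \<xi> where "F (x + d) = F x + d \<bullet> g + d \<bullet> (hessian F \<xi> *v d) / 2"
    using second_order_expansion[OF F] unfolding g_def by blast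
  then have "F x + d \<bullet> g + \<gamma> * (d \<bullet> d) / 2 \<le> F z"
    using lo[of d \<xi>] by (simp add: d_def)
  \<comment> \<open>With this factor the right side is the gradient's square minus the square of g +
    \<gamma> d.\<close>
  from mult_left_mono[OF this, of "2 * \<gamma>"]
  have "2 * \<gamma> * (F x - F z) \<le> - (2 * \<gamma> * (d \<bullet> g) + \<gamma>\<^sup>2 * (d \<bullet> d))"
    using \<open>0 < \<gamma>\<close> by (simp add: algebra_simps power2_eq_square)
  also have "\<dots> \<le> g \<bullet> g"
  proof -
    have "0 \<le> (g + \<gamma> *\<^sub>R d) \<bullet> (g + \<gamma> *\<^sub>R d)"
      by simp
    then show ?thesis
      by (simp add: inner_add_left inner_add_right inner_commute power2_eq_square algebra_simps)
  qed
  finally show ?thesis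
    by (simp add: g_def)
qed

text \<open>The largest step must be attained. One admissible \<open>a0\<close> cuts the search down
  to a compact set, closed by continuity of \<open>F\<close>; smaller admissible steps cannot exceed
  its maximum.\<close>

lemma line_search_step_exists:
  assumes cont: "continuous_on UNIV F" and a0: "a0 \<le> \<alpha>max" "armijo F \<beta> x d a0"
  shows "\<exists>\<alpha>\<ge>a0. line_search_step F \<beta> \<alpha>max x d \<alpha>"
proof -
  define A where "A = {a. a0 \<le> a \<and> a \<le> \<alpha>max \<and> armijo F \<beta> x d a}"
  have eq: "A = {a0..\<alpha>max} \<inter> {a. F (x + a *\<^sub>R d) - (F x + a * \<beta> * (d \<bullet> gradient F x)) \<le> 0}"
    by (auto simp: A_def armijo_def)
  have "continuous_on UNIV (\<lambda>a. F (x + a *\<^sub>R d) - (F x + a * \<beta> * (d \<bullet> gradient F x)))"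
    by (intro continuous_intros continuous_on_compose2[OF cont]) auto
  then have "closed {a. F (x + a *\<^sub>R d) - (F x + a * \<beta> * (d \<bullet> gradient F x)) \<le> 0}"
    by (intro closed_Collect_le) (auto intro: continuous_on_const)
  then have "compact A"
    unfolding eq by (intro compact_Int_closed) auto
  moreover have "a0 \<in> A"
    using a0 by (simp add: A_def)
  ultimately obtain \<alpha> where \<alpha>: "\<alpha> \<in> A" "\<And>a. a \<in> A \<Longrightarrow> a \<le> \<alpha>"
    using compact_attains_sup[of A] by blast
  have "a \<le> \<alpha>" if "a \<le> \<alpha>max" "armijo F \<beta> x d a" for a
    using \<alpha> that by (cases "a0 \<le> a") (auto simp: A_def)
  then show ?thesis
    using \<alpha>(1) by (auto simp: A_def line_search_step_def)
qed

text \<open>The deterministic part, for a fixed sample. With w = H^(-1) g everything is measured by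
  w . H w = - d . g: \<open>loH\<close> compares it with |w|^2, which controls the step length, and
  \<open>upH\<close> with |g|^2, which controls the decrease.\<close>

lemma newton_iteration_progress:
  fixes f :: "nat \<Rightarrow> real ^ 'p \<Rightarrow> real" and S :: "nat list" and n :: nat and x z :: "real ^ 'p"
  defines "F \<equiv> objective n f" and "H \<equiv> sub_hessian f S x"
  assumes F: "twice_differentiable F"
    and lo: "\<And>z v. \<gamma> * (v \<bullet> v) \<le> v \<bullet> (hessian F z *v v)"
    and up: "\<And>z v. v \<bullet> (hessian F z *v v) \<le> K * (v \<bullet> v)"
    and \<gamma>: "0 < \<gamma>" "\<gamma> \<le> K" and \<epsilon>: "\<epsilon> < 1" and \<beta>: "0 < \<beta>" "\<beta> < 1" and \<alpha>max: "1 \<le> \<alpha>max"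
    and symH: "transpose H = H"
    and loH: "\<And>v. (1 - \<epsilon>) * \<gamma> * (v \<bullet> v) \<le> v \<bullet> (H *v v)"
    and upH: "\<And>v. v \<bullet> (H *v v) \<le> Kt * (v \<bullet> v)" and Kt: "0 < Kt"
  shows "\<exists>\<alpha> y. newton_iteration n f \<beta> \<alpha>max S x \<alpha> y \<and>
    F y - F z \<le> (1 - 2 * \<alpha> * \<beta> / (Kt / \<gamma>)) * (F x - F z) \<and>
    \<alpha> \<ge> min \<alpha>max (2 * (1 - \<beta>) * (1 - \<epsilon>) / (K / \<gamma>))"
proof -
  define g where "g = gradient F x"
  define w where "w = matrix_inv H *v g"
  define d where "d = - w"
  have h: "0 < (1 - \<epsilon>) * \<gamma>"
    using \<epsilon> \<gamma> by simp
  have posH: "0 \<le> v \<bullet> (H *v v)" for v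
    by (rule order_trans[OF _ loH]) (use h in simp)
  have "v = 0" if "H *v v = 0" for v
  proof -
    have "(1 - \<epsilon>) * \<gamma> * (v \<bullet> v) \<le> (1 - \<epsilon>) * \<gamma> * 0"
      using loH[of v] that by simp
    then have "v \<bullet> v \<le> 0"
      using h by (simp only: mult_le_cancel_left_pos)
    then show ?thesis
      by (metis inner_eq_zero_iff inner_ge_zero order_antisym)
  qed
  then have inv: "invertible H"
    using matrix_left_invertible_ker[of H] by (simp add: invertible_left_inverse)
  then have Hw: "H *v w = g"
    by (simp add: w_def matrix_vector_mul_assoc matrix_mult_matrix_inv)
  have dir: "newton_direction n f S x = d"
    by (simp add: newton_direction_def d_def w_def g_def F_def H_def)
  have dg: "d \<bullet> g = - (w \<bullet> (H *v w))"
    by (simp add: d_def Hw)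
  \<comment> \<open>A step a meets the Armijo condition once a K |w|^2 \<le> 2 (1 - \<beta>) w . H
    w, by the Taylor upper bound; inserting w . H w \<ge> (1 - \<epsilon>) \<gamma> |w|^2 gives the
    second argument of the minimum.\<close>
  define a0 where "a0 = min \<alpha>max (2 * (1 - \<beta>) * (1 - \<epsilon>) / (K / \<gamma>))"
  have K: "0 < K"
    using \<gamma> by simp
  have a0: "0 < a0"
    using \<alpha>max \<beta> \<epsilon> \<gamma> K by (simp add: a0_def)
  have "armijo F \<beta> x d a0"
  proof -
    obtain \<xi> where "F (x + a0 *\<^sub>R d) = F x + (a0 *\<^sub>R d) \<bullet> gradient F x +
        (a0 *\<^sub>R d) \<bullet> (hessian F \<xi> *v (a0 *\<^sub>R d)) / 2"
      using second_order_expansion[OF F] by blast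
    also have "\<dots> \<le> F x + a0 * (d \<bullet> g) + a0 * (a0 * K * (w \<bullet> w)) / 2"
      using up[of "a0 *\<^sub>R d" \<xi>] by (simp add: g_def d_def mult_ac)
    also have "a0 * K * (w \<bullet> w) \<le> 2 * (1 - \<beta>) * (w \<bullet> (H *v w))"
    proof -
      have "a0 * K \<le> 2 * (1 - \<beta>) * (1 - \<epsilon>) / (K / \<gamma>) * K"
        using K by (intro mult_right_mono) (auto simp: a0_def)
      also have "\<dots> = 2 * (1 - \<beta>) * ((1 - \<epsilon>) * \<gamma>)"
        using K by simp
      finally have "a0 * K * (w \<bullet> w) \<le> 2 * (1 - \<beta>) * ((1 - \<epsilon>) * \<gamma>) * (w \<bullet> w)"
        by (rule mult_right_mono) simp
      also have "\<dots> = 2 * (1 - \<beta>) * ((1 - \<epsilon>) * \<gamma> * (w \<bullet> w))"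
        by simp
      also have "\<dots> \<le> 2 * (1 - \<beta>) * (w \<bullet> (H *v w))"
        using \<beta> by (intro mult_left_mono loH) auto
      finally show ?thesis .
    qed
    finally have "F (x + a0 *\<^sub>R d) \<le> F x + a0 * (d \<bullet> g) + a0 * (2 * (1 - \<beta>) * (w \<bullet> (H *v w))) / 2"
      using a0 by (simp add: mult_left_mono)
    also have "\<dots> = F x + a0 * \<beta> * (d \<bullet> g)"
      by (simp add: dg algebra_simps diff_divide_distrib)
    finally show ?thesis
      by (simp add: armijo_def g_def)
  qed
  moreover have "continuous_on UNIV F"
    using F by (auto simp: twice_differentiable_def intro!: continuous_at_imp_continuous_on
        differentiable_imp_continuous_within)
  moreover have "a0 \<le> \<alpha>max"
    by (simp add: a0_def)
  ultimately obtain \<alpha> where \<alpha>: "a0 \<le> \<alpha>" "line_search_step F \<beta> \<alpha>max x d \<alpha>"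
    using line_search_step_exists by blast
  define y where "y = x + \<alpha> *\<^sub>R d"
  have "newton_iteration n f \<beta> \<alpha>max S x \<alpha> y"
    using inv \<alpha>(2) by (simp add: newton_iteration_def dir y_def F_def H_def)
  moreover have "F y - F z \<le> (1 - 2 * \<alpha> * \<beta> / (Kt / \<gamma>)) * (F x - F z)"
  proof -
    \<comment> \<open>Gradient dominance bounds the gap by |g|^2 = |H w|^2, and H^2 \<preceq> Kt H
      bounds that by Kt (w . H w).\<close>
    have "2 * \<gamma> * (F x - F z) \<le> Kt * (w \<bullet> (H *v w))"
      using gradient_dominance[OF F lo \<gamma>(1), of x z] psd_norm_bound[OF symH posH upH Kt, of w]
      by (simp add: Hw g_def)
    then have "2 * \<gamma> * (F x - F z) / Kt \<le> w \<bullet> (H *v w)"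
      using Kt by (simp add: pos_divide_le_eq mult.commute)
    then have "\<alpha> * \<beta> * (2 * \<gamma> * (F x - F z) / Kt) \<le> \<alpha> * \<beta> * (w \<bullet> (H *v w))"
      using a0 \<alpha>(1) \<beta> by (intro mult_left_mono) auto
    moreover have "F y \<le> F x - \<alpha> * \<beta> * (w \<bullet> (H *v w))"
      using \<alpha>(2) by (simp add: line_search_step_def armijo_def y_def g_def[symmetric] dg)
    ultimately have "F y - F z \<le> (F x - F z) - \<alpha> * \<beta> * (2 * \<gamma> * (F x - F z) / Kt)"
      by simp
    also have "\<dots> = (1 - 2 * \<alpha> * \<beta> / (Kt / \<gamma>)) * (F x - F z)"
      by (simp add: algebra_simps)
    finally show ?thesis .
  qed
  ultimately show ?thesis
    using \<alpha>(1) by (auto simp: a0_def)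
qed

theorem theorem1:
  fixes f :: "nat \<Rightarrow> real ^ 'p \<Rightarrow> real"
    and n m :: nat
    and Ks :: "nat \<Rightarrow> real"
    and K \<gamma> \<delta> \<epsilon> \<beta> \<alpha>max :: real
    and x xstar :: "real ^ 'p"
    and md :: sampling
  assumes n_pos: "n \<ge> 1"
    and twice_diff: "\<And>i. i \<in> {1..n} \<Longrightarrow> twice_differentiable (f i)"
    and Ks_pos: "\<And>i. i \<in> {1..n} \<Longrightarrow> 0 < Ks i"
    and hess_f: "\<And>i z. i \<in> {1..n} \<Longrightarrow> 0 \<preceq> hessian (f i) z \<and> hessian (f i) z \<preceq> mat (Ks i)"
    and \<gamma>_pos: "0 < \<gamma>" and \<gamma>_le_K: "\<gamma> \<le> K"
    and hess_F: "\<And>z. mat \<gamma> \<preceq> hessian (objective n f) z \<and> hessian (objective n f) z \<preceq> mat K"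
    and minimizer: "\<And>z. objective n f xstar \<le> objective n f z"
    and \<delta>: "0 < \<delta>" "\<delta> < 1"
    and \<epsilon>: "0 < \<epsilon>" "\<epsilon> < 1"
    and \<beta>: "0 < \<beta>" "\<beta> < 1"
    and \<alpha>max: "1 \<le> \<alpha>max"
    and sample_size: "real m \<ge> 2 * cond_num n Ks \<gamma> 1 * ln (real CARD('p) / \<delta>) / \<epsilon>\<^sup>2"
    and sample_exists: "md = Without_Replacement \<Longrightarrow> m \<le> n"
  shows "measure_pmf.prob (sample_pmf md n m)
           {S. \<exists>\<alpha> y. newton_iteration n f \<beta> \<alpha>max S x \<alpha> y \<and>
                objective n f y - objective n f xstar
                  \<le> (1 - 2 * \<alpha> * \<beta> / sample_cond_num md n Ks \<gamma> m)
                      * (objective n f x - objective n f xstar) \<and>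
                \<alpha> \<ge> min \<alpha>max (2 * (1 - \<beta>) * (1 - \<epsilon>) / (K / \<gamma>))}
         \<ge> 1 - \<delta>"
proof -
  define X where "X i = hessian (f i) x" for i
  define R where "R = top_avg n Ks 1"
  define F where "F = objective n f"
  have F2: "twice_differentiable F"
    unfolding F_def using n_pos twice_diff by (rule twice_differentiable_objective)
  have loF: "\<gamma> * (v \<bullet> v) \<le> v \<bullet> (hessian F z *v v)"
    and upF: "v \<bullet> (hessian F z *v v) \<le> K * (v \<bullet> v)" for z v
    using loewner_leD(1)[of "mat \<gamma>" "hessian F z" v] loewner_leD(1)[of "hessian F z" "mat K" v] hess_F[of z]
    by (simp_all add: F_def mat_vector_mult)
  have symX: "transpose (X i) = X i" and posX: "0 \<le> v \<bullet> (X i *v v)"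
    and leX: "v \<bullet> (X i *v v) \<le> Ks i * (v \<bullet> v)" if "i \<in> {1..n}" for i v
    using loewner_leD(1)[of 0 "X i" v] loewner_leD(2)[of 0 "X i"] loewner_leD(1)[of "X i" "mat (Ks i)" v] hess_f[OF that, of x]
    by (simp_all add: X_def mat_vector_mult)
  have R: "0 < R"
    using le_top_avg_1[of 1 n Ks] Ks_pos[of 1] n_pos by (simp add: R_def)
  interpret bounded_psd_family X n R \<gamma>
  proof
    show "v \<bullet> (X i *v v) \<le> R * (v \<bullet> v)" if "i \<in> {1..n}" for i v
      unfolding R_def
      by (rule order_trans[OF leX[OF that] mult_right_mono[OF le_top_avg_1[OF that, of Ks]]]) simp
    show "real n * \<gamma> * (v \<bullet> v) \<le> (\<Sum>i\<in>{1..n}. v \<bullet> (X i *v v))" for v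
    proof -
      have "hessian F x *v v = (1 / real n) *\<^sub>R (\<Sum>i\<in>{1..n}. X i *v v)"
        unfolding F_def X_def using n_pos twice_diff by (rule hessian_objective)
      then have "real n * (v \<bullet> (hessian F x *v v)) = (\<Sum>i\<in>{1..n}. v \<bullet> (X i *v v))"
        using n_pos by (simp add: inner_sum_right)
      then show ?thesis
        using mult_left_mono[OF loF[of v x], of "real n"] by (simp add: mult.assoc)
    qed
  qed (use n_pos symX posX \<gamma>_pos in auto)
  \<comment> \<open>The averages over the sample divide by m. It is positive because \<delta> < 1
    \<le> p makes the logarithm in the sample size positive.\<close>
  have m: "0 < m"
  proof (rule ccontr)
    assume "\<not> 0 < m"
    moreover have "0 < ln (real CARD('p) / \<delta>)"
    proof -
      have "1 \<le> real CARD('p)"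
        using zero_less_card_finite[where 'a = 'p] by linarith
      then have "\<delta> < real CARD('p)"
        using \<delta> by linarith
      then show ?thesis
        using \<delta> by (simp add: less_divide_eq)
    qed
    ultimately show False
      using sample_size R \<gamma>_pos \<epsilon> by (simp add: cond_num_def R_def divide_le_0_iff mult_le_0_iff)
  qed
  \<comment> \<open>With replacement an index may recur, so only the largest \<open>Ks i\<close>
    bounds the sample average; distinct indices allow the average of the m largest.\<close>
  define Kt where "Kt = (case md of With_Replacement \<Rightarrow> R | Without_Replacement \<Rightarrow> top_avg n Ks m)"
  define good where "good = {L. L \<in> samples md n m \<and>
    (\<forall>v. (1 - \<epsilon>) * \<gamma> * real m * (v \<bullet> v) \<le> v \<bullet> ((\<Sum>j\<leftarrow>L. X j) *v v))}"
  have "1 - \<delta> \<le> measure_pmf.prob (sample_pmf md n m) good"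
    unfolding good_def using sample_size
    by (intro prob_sum_ge sample_exists \<delta> \<epsilon>) (simp_all add: cond_num_def R_def)
  also have "\<dots> \<le> measure_pmf.prob (sample_pmf md n m)
      {S. \<exists>\<alpha> y. newton_iteration n f \<beta> \<alpha>max S x \<alpha> y \<and>
        F y - F xstar \<le> (1 - 2 * \<alpha> * \<beta> / sample_cond_num md n Ks \<gamma> m) * (F x - F xstar) \<and>
        \<alpha> \<ge> min \<alpha>max (2 * (1 - \<beta>) * (1 - \<epsilon>) / (K / \<gamma>))}"
  \<comment> \<open>From here on the sample is fixed: every good sample is shown to satisfy all
    conclusions at once.\<close>
  proof (intro measure_pmf.finite_measure_mono subsetI CollectI)
    fix L assume L: "L \<in> good"
    note sL = set_samples_subset[of L md n m] length_samples[of L md n m]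
    have L1: "set L \<subseteq> {1..n}" "length L = m"
      using L sL by (auto simp: good_def)
    define H where "H = sub_hessian f L x"
    have vH: "v \<bullet> (H *v v) = v \<bullet> ((\<Sum>j\<leftarrow>L. X j) *v v) / real m" for v
      by (simp add: H_def sub_hessian_def L1 scaleR_matrix_vector X_def)
    have symH: "transpose H = H"
      using sum_list_family(1)[OF L1(1)] by (simp add: H_def sub_hessian_def transpose_scalar X_def)
    have loH: "(1 - \<epsilon>) * \<gamma> * (v \<bullet> v) \<le> v \<bullet> (H *v v)" for v
    proof -
      have "(1 - \<epsilon>) * \<gamma> * real m * (v \<bullet> v) \<le> v \<bullet> ((\<Sum>j\<leftarrow>L. X j) *v v)"
        using L by (auto simp: good_def)
      then show ?thesis
        using m by (simp add: vH pos_le_divide_eq mult_ac)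
    qed
    have sumK: "(\<Sum>j\<leftarrow>L. Ks j) \<le> real m * Kt"
    proof (cases md)
      case With_Replacement
      have "(\<Sum>j\<leftarrow>L. Ks j) \<le> (\<Sum>j\<leftarrow>L. R)"
        unfolding R_def using L1(1) by (intro sum_list_mono le_top_avg_1) auto
      then show ?thesis
        using With_Replacement L1(2) by (simp add: Kt_def sum_list_triv)
    next
      case Without_Replacement
      then have "distinct L"
        using L by (simp add: good_def)
      then show ?thesis
        using sum_list_le_top_avg[OF _ L1(1), of Ks] Without_Replacement L1(2) by (simp add: Kt_def)
    qed
    have upH: "v \<bullet> (H *v v) \<le> Kt * (v \<bullet> v)" for v
    proof -
      have "v \<bullet> ((\<Sum>j\<leftarrow>L. X j) *v v) = (\<Sum>j\<leftarrow>L. v \<bullet> (X j *v v))"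
        by (simp add: sum_list_matrix_vector inner_sum_list_right)
      also have "\<dots> \<le> (\<Sum>j\<leftarrow>L. Ks j * (v \<bullet> v))"
        using L1(1) by (intro sum_list_mono leX) auto
      also have "\<dots> = (\<Sum>j\<leftarrow>L. Ks j) * (v \<bullet> v)"
        by (rule sum_list_mult_const)
      also have "\<dots> \<le> real m * Kt * (v \<bullet> v)"
        by (intro mult_right_mono sumK) simp
      finally show ?thesis
        using m by (simp add: vH pos_divide_le_eq mult_ac)
    qed
    have "0 < (\<Sum>j\<leftarrow>L. Ks j)"
    proof -
      obtain i L' where "L = i # L'"
        using L1(2) m by (cases L) auto
      moreover have "0 \<le> (\<Sum>j\<leftarrow>L'. Ks j)"
        using L1(1) calculation by (intro sum_list_nonneg) (auto intro!: less_imp_le[OF Ks_pos])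
      ultimately show ?thesis
        using Ks_pos[of i] L1(1) by simp
    qed
    then have Kt: "0 < Kt"
      using sumK m by (smt (verit) mult_nonneg_nonpos of_nat_0_le_iff)
    have "sample_cond_num md n Ks \<gamma> m = Kt / \<gamma>"
      by (cases md) (simp_all add: Kt_def cond_num_def R_def)
    then show "\<exists>\<alpha> y. newton_iteration n f \<beta> \<alpha>max L x \<alpha> y \<and>
        F y - F xstar \<le> (1 - 2 * \<alpha> * \<beta> / sample_cond_num md n Ks \<gamma> m) * (F x - F xstar) \<and>
        \<alpha> \<ge> min \<alpha>max (2 * (1 - \<beta>) * (1 - \<epsilon>) / (K / \<gamma>))"
      using newton_iteration_progress[OF F2[unfolded F_def] loF[unfolded F_def] upF[unfolded F_def]
          \<gamma>_pos \<gamma>_le_K \<epsilon>(2) \<beta> \<alpha>max symH[unfolded H_def] loH[unfolded H_def] upH[unfolded H_def] Kt]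
      by (simp add: F_def)
  qed simp
  finally show ?thesis
    by (simp add: F_def)
qed

end
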